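(* Let $n\ge1$ and let $\Psi$ be an admissible doubling decay. Then, for $f\in\mathcal{S}'(\mathbb{R}^n)$, $$\|f\|_{V_\Psi(\mathbb{R}^n)}\approx\sup_{t\in(0,1)}\frac{K(t,f;B^{-2}_{\infty,1}(\mathbb{R}^n),B^0_{\infty,1}(\mathbb{R}^n))}{\Psi(-\log t)^2}.$$
   Context: A decay is a positive decreasing $\Psi$ on $[0,\infty)$ with $\Psi(t)\to0$; admissible: $\sum_{r=0}^N(2^r\Psi(r))^2\le C(2^N\Psi(N))^2$ for all $N\in\mathbb{N}_0$; doubling: $\Psi(ct)\ge C'\Psi(t)$ for some $c>1$, $C'>0$ and all $t$. $\{\Delta_j\}_{j\in\mathbb{N}_0}$ are the standard inhomogeneous Littlewood–Paley operators; $B^s_{\infty,1}(\mathbb{R}^n)$ is normed by $\sum_{j\ge0}2^{js}\|\Delta_jf\|_{L^\infty}$. $V_\Psi(\mathbb{R}^n)$: $\|f\|_{V_\Psi}=\sup_{N\in\mathbb{N}_0}\Psi(N)^{-2}\sum_{j=N}^\infty2^{-2j}\|\Delta_jf\|_{L^\infty}$. For a compatible pair $(A_0,A_1)$ of Banach spaces, $K(t,f;A_0,A_1)=\inf_{f=f_0+f_1}(\|f_0\|_{A_0}+t\|f_1\|_{A_1})$. *)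

theory Defs
  imports "HOL-Analysis.Analysis"
begin

definition decay :: "(real \<Rightarrow> real) \<Rightarrow> bool" where
  "decay \<Psi> \<longleftrightarrow> (\<forall>t\<ge>0. \<Psi> t > 0) \<and> (\<forall>s t. 0 \<le> s \<and> s \<le> t \<longrightarrow> \<Psi> t \<le> \<Psi> s)
     \<and> (\<Psi> \<longlongrightarrow> 0) at_top"

definition admissible :: "(real \<Rightarrow> real) \<Rightarrow> bool" where
  "admissible \<Psi> \<longleftrightarrow> (\<exists>C. \<forall>N::nat.
     (\<Sum>r\<le>N. (2 ^ r * \<Psi> (real r))\<^sup>2) \<le> C * (2 ^ N * \<Psi> (real N))\<^sup>2)"

definition doubling :: "(real \<Rightarrow> real) \<Rightarrow> bool" where
  "doubling \<Psi> \<longleftrightarrow> (\<exists>c C'. c > 1 \<and> C' > 0 \<and> (\<forall>t\<ge>0. \<Psi> (c * t) \<ge> C' * \<Psi> t))"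

text \<open>Partial derivative in the i-th coordinate direction, and iterated partial derivatives
  (a list of coordinate indices plays the role of a multi-index).\<close>
definition pdiff :: "'n::finite \<Rightarrow> (real^'n \<Rightarrow> complex) \<Rightarrow> real^'n \<Rightarrow> complex" where
  "pdiff i g x = frechet_derivative g (at x) (axis i 1)"

fun iter_pdiff :: "'n::finite list \<Rightarrow> (real^'n \<Rightarrow> complex) \<Rightarrow> real^'n \<Rightarrow> complex" where
  "iter_pdiff [] g = g"
| "iter_pdiff (i # is) g = pdiff i (iter_pdiff is g)"

definition schwartz :: "(real^'n::finite \<Rightarrow> complex) \<Rightarrow> bool" where
  "schwartz \<phi> \<longleftrightarrow>
     (\<forall>is x. iter_pdiff is \<phi> differentiable (at x)) \<and>
     (\<forall>is (k::nat). bounded (range (\<lambda>x. (1 + norm x) ^ k * norm (iter_pdiff is \<phi> x))))"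

definition schwartz_seminorm :: "nat \<Rightarrow> (real^'n::finite \<Rightarrow> complex) \<Rightarrow> real" where
  "schwartz_seminorm N \<phi> =
     (\<Sum>is\<in>{is::'n list. length is \<le> N}. \<Sum>k\<le>N.
        (SUP x. (1 + norm x) ^ k * norm (iter_pdiff is \<phi> x)))"

text \<open>Tempered distributions: continuous linear functionals on the Schwartz space
  (values on non-Schwartz functions are irrelevant).\<close>
definition tempered :: "((real^'n::finite \<Rightarrow> complex) \<Rightarrow> complex) \<Rightarrow> bool" where
  "tempered T \<longleftrightarrow>
     (\<forall>\<phi> \<psi> (a::complex). schwartz \<phi> \<and> schwartz \<psi> \<longrightarrow>
        T (\<lambda>x. a * \<phi> x + \<psi> x) = a * T \<phi> + T \<psi>) \<and>
     (\<exists>C N. \<forall>\<phi>. schwartz \<phi> \<longrightarrow> norm (T \<phi>) \<le> C * schwartz_seminorm N \<phi>)"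

definition fourier :: "(real^'n::finite \<Rightarrow> complex) \<Rightarrow> real^'n \<Rightarrow> complex" where
  "fourier \<phi> \<xi> = (LINT x|lborel. \<phi> x * cis (- (x \<bullet> \<xi>)))"

definition LP_generator :: "(real^'n::finite \<Rightarrow> complex) \<Rightarrow> bool" where
  "LP_generator \<phi> \<longleftrightarrow> schwartz \<phi> \<and>
     (\<forall>\<xi>. norm \<xi> \<le> 1 \<longrightarrow> fourier \<phi> \<xi> = 1) \<and>
     (\<forall>\<xi>. norm \<xi> \<ge> 2 \<longrightarrow> fourier \<phi> \<xi> = 0)"

definition LP_kernel :: "(real^'n::finite \<Rightarrow> complex) \<Rightarrow> nat \<Rightarrow> real^'n \<Rightarrow> complex" where
  "LP_kernel \<phi> j y =
     (if j = 0 then \<phi> y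
      else of_real (2 ^ (j * CARD('n))) * \<phi> ((2 ^ j) *\<^sub>R y)
         - of_real (2 ^ ((j - 1) * CARD('n))) * \<phi> ((2 ^ (j - 1)) *\<^sub>R y))"

text \<open>\<Delta>_j f (x) = (\<phi>_j * f)(x) = f(\<phi>_j(x - .)).\<close>
definition LP :: "(real^'n::finite \<Rightarrow> complex) \<Rightarrow> nat \<Rightarrow> ((real^'n \<Rightarrow> complex) \<Rightarrow> complex)
                    \<Rightarrow> real^'n \<Rightarrow> complex" where
  "LP \<phi> j f x = f (\<lambda>y. LP_kernel \<phi> j (x - y))"

text \<open>L^\<infinity> norm of \<Delta>_j f (a continuous function), possibly infinite.\<close>
definition LP_sup :: "(real^'n::finite \<Rightarrow> complex) \<Rightarrow> nat \<Rightarrow> ((real^'n \<Rightarrow> complex) \<Rightarrow> complex)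
                       \<Rightarrow> ennreal" where
  "LP_sup \<phi> j f = (SUP x. ennreal (norm (LP \<phi> j f x)))"

definition besov_inf1 :: "(real^'n::finite \<Rightarrow> complex) \<Rightarrow> real \<Rightarrow> ((real^'n \<Rightarrow> complex) \<Rightarrow> complex)
                          \<Rightarrow> ennreal" where
  "besov_inf1 \<phi> s f = (\<Sum>j. ennreal (2 powr (s * real j)) * LP_sup \<phi> j f)"

definition V_norm :: "(real^'n::finite \<Rightarrow> complex) \<Rightarrow> (real \<Rightarrow> real) \<Rightarrow> ((real^'n \<Rightarrow> complex) \<Rightarrow> complex)
                      \<Rightarrow> ennreal" where
  "V_norm \<phi> \<Psi> f = (SUP N::nat. ennreal (1 / (\<Psi> (real N))\<^sup>2) *
                        (\<Sum>j. ennreal (2 powr (- 2 * real (j + N))) * LP_sup \<phi> (j + N) f))"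

text \<open>K-functional for the pair (B^{-2}_{\<infinity>,1}, B^0_{\<infinity>,1}); infimum over decompositions
  f = f0 + f1 into tempered distributions (infinite if none has finite norms).\<close>
definition K_besov :: "(real^'n::finite \<Rightarrow> complex) \<Rightarrow> real \<Rightarrow> ((real^'n \<Rightarrow> complex) \<Rightarrow> complex)
                       \<Rightarrow> ennreal" where
  "K_besov \<phi> t f = (INF p \<in> {(f0, f1). tempered f0 \<and> tempered f1 \<and>
                         (\<forall>\<psi>. schwartz \<psi> \<longrightarrow> f \<psi> = f0 \<psi> + f1 \<psi>)}.
                       besov_inf1 \<phi> (-2) (fst p) + ennreal t * besov_inf1 \<phi> 0 (snd p))"

end

theory Submission
  imports Defs
begin

text \<open>
  Both inequalities come from comparing \<open>K(t, f)\<close> for \<open>t \<approx> 4\<^sup>-\<^sup>N\<close> with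
  \<open>\<Sum>\<^sub>j\<^sub>\<ge>\<^sub>N 2\<^sup>-\<^sup>2\<^sup>j a\<^sub>j + t \<Sum>\<^sub>j\<^sub>\<le>\<^sub>N a\<^sub>j\<close>, where \<open>a\<^sub>j\<close> is the sup norm of the j-th Littlewood--Paley piece of f.
  The lower bound needs only that \<open>a\<^sub>j\<close> is subadditive in f. For the upper bound, f is split at frequency
  \<open>2\<^sup>N\<close>: the low part \<open>f * \<phi>\<^sub>N\<close> has the same pieces as f below N and none above \<open>N + 1\<close>, by injectivity of
  the Fourier transform, and the two remaining pieces are averages of translates of those of f, so they are bounded by
  \<open>\<parallel>\<phi>\<parallel>\<^sub>1 a\<^sub>j\<close>. Since \<open>a\<^sub>j \<le> (2\<^sup>j \<Psi>(j))\<^sup>2 \<parallel>f\<parallel>\<close> in the V-norm, admissibility bounds the low-frequency sum, and doubling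
  absorbs the factor relating \<open>- ln t\<close> to N.
\<close>

section \<open>Schwartz functions\<close>

text \<open>A tempered distribution is a bare functional here, so each operation on f is moved to
  the test function by duality, and the Fourier transform is only ever applied to integrable
  functions. The obstacle is to pull f out of an integral of translates: f is known to be linear and
  bounded by finitely many Schwartz seminorms, so finite sums of translates have to approach the
  average in those seminorms. The weighted difference estimates below exist for that. Two pieces
  survive the split on both sides because the transform of \<open>dilate \<phi> N\<close> falls from
  1 to 0 between radius 2^N and 2^(N+1), a shell met by the frequency ranges of the kernels of index
  N and N + 1. The hypotheses on \<Psi> enter asymmetrically. For the lower bound t is at our
  disposal and can be taken with - ln t \<ge> N, so monotonicity gives the constant 1/2. For the
  upper bound t is given and - ln t may exceed N, which is where doubling enters. Admissibility says
  that the low-frequency sum is controlled by its last term.\<close>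

lemma has_derivative_pdiff:
  fixes g :: "real^'n::finite \<Rightarrow> complex"
  assumes "g differentiable (at x)"
  shows "(g has_derivative (\<lambda>h. \<Sum>i\<in>UNIV. (h $ i) *\<^sub>R pdiff i g x)) (at x)"
proof -
  let ?D = "frechet_derivative g (at x)"
  have D: "(g has_derivative ?D) (at x)"
    using assms frechet_derivative_works by blast
  then have lin: "linear ?D"
    using has_derivative_linear by blast
  have "?D h = (\<Sum>i\<in>UNIV. (h $ i) *\<^sub>R pdiff i g x)" for h
  proof -
    have "?D h = ?D (\<Sum>i\<in>UNIV. (h $ i) *\<^sub>R axis i 1)"
      using basis_expansion[of h] by (simp add: scalar_mult_eq_scaleR)
    then show ?thesis
      by (simp add: linear_sum[OF lin] linear_scale[OF lin] pdiff_def)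
  qed
  then have "?D = (\<lambda>h. \<Sum>i\<in>UNIV. (h $ i) *\<^sub>R pdiff i g x)" by blast
  with D show ?thesis by simp
qed

lemma pdiff_eqI:
  assumes "(g has_derivative D) (at x)"
  shows "pdiff i g x = D (axis i 1)"
  unfolding pdiff_def frechet_derivative_at[OF assms, symmetric] ..

lemma onorm_gradient_le:
  fixes p :: "'n::finite \<Rightarrow> complex"
  shows "onorm (\<lambda>h::real^'n. \<Sum>i\<in>UNIV. (h $ i) *\<^sub>R p i) \<le> (\<Sum>i\<in>UNIV. norm (p i))"
proof (rule onorm_le)
  fix h :: "real^'n"
  have "norm (\<Sum>i\<in>UNIV. (h $ i) *\<^sub>R p i) \<le> (\<Sum>i\<in>UNIV. norm h * norm (p i))"
    by (rule sum_norm_le) (simp add: component_le_norm_cart mult_right_mono)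
  then show "norm (\<Sum>i\<in>UNIV. (h $ i) *\<^sub>R p i) \<le> (\<Sum>i\<in>UNIV. norm (p i)) * norm h"
    by (simp add: sum_distrib_left[symmetric] mult.commute)
qed

lemma schwartz_differentiable: "schwartz h \<Longrightarrow> iter_pdiff is h differentiable (at x)"
  by (simp add: schwartz_def)

lemma schwartz_bound:
  assumes "schwartz h"
  obtains C where "C \<ge> 0" "\<And>x. (1 + norm x) ^ k * norm (iter_pdiff is h x) \<le> C"
proof -
  have "bounded (range (\<lambda>x. (1 + norm x) ^ k * norm (iter_pdiff is h x)))"
    using assms by (simp add: schwartz_def)
  then obtain C where C: "\<And>x. norm ((1 + norm x) ^ k * norm (iter_pdiff is h x)) \<le> C"
    unfolding bounded_iff by blast
  have "(1 + norm x) ^ k * norm (iter_pdiff is h x) \<le> C" for x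
    using C[of x] by simp
  moreover have "C \<ge> 0" using C[of 0] norm_ge_zero order_trans by blast
  ultimately show thesis using that by blast
qed

lemma schwartzI:
  assumes "\<And>is x. iter_pdiff is h differentiable (at x)"
    and "\<And>is k. \<exists>C. \<forall>x. (1 + norm x) ^ k * norm (iter_pdiff is h x) \<le> C"
  shows "schwartz h"
  unfolding schwartz_def
proof (intro conjI allI)
  fix "is" and k :: nat
  obtain C where C: "\<And>x. (1 + norm x) ^ k * norm (iter_pdiff is h x) \<le> C"
    using assms(2) by blast
  show "bounded (range (\<lambda>x. (1 + norm x) ^ k * norm (iter_pdiff is h x)))"
    unfolding bounded_iff by (rule exI[of _ C]) (auto simp: C)
qed (rule assms(1))

lemma iter_pdiff_append: "iter_pdiff (xs @ ys) h = iter_pdiff xs (iter_pdiff ys h)"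
  by (induction xs) auto

lemma schwartz_iter_pdiff:
  assumes "schwartz h"
  shows "schwartz (iter_pdiff js h)"
proof (rule schwartzI)
  show "iter_pdiff is (iter_pdiff js h) differentiable (at x)" for "is" x
    using schwartz_differentiable[OF assms] by (simp add: iter_pdiff_append[symmetric])
  show "\<exists>C. \<forall>x. (1 + norm x) ^ k * norm (iter_pdiff is (iter_pdiff js h) x) \<le> C" for "is" k
    using schwartz_bound[OF assms, of k "is @ js"] by (metis iter_pdiff_append)
qed

lemma schwartz_continuous: "schwartz h \<Longrightarrow> continuous_on UNIV (iter_pdiff is h)"
  by (simp add: schwartz_def continuous_at_imp_continuous_on differentiable_imp_continuous_within)

lemma iter_pdiff_borel_measurable: "schwartz h \<Longrightarrow> iter_pdiff is h \<in> borel_measurable borel"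
  by (intro borel_measurable_continuous_onI schwartz_continuous)

lemma schwartz_borel_measurable: "schwartz h \<Longrightarrow> h \<in> borel_measurable borel"
  using iter_pdiff_borel_measurable[of h "[]"] by simp

lemma iter_pdiff_lincomb:
  assumes "schwartz h" "schwartz k"
  shows "iter_pdiff is (\<lambda>x. a * h x + k x) = (\<lambda>x. a * iter_pdiff is h x + iter_pdiff is k x)"
proof (induction "is")
  case (Cons i "is")
  have "pdiff i (\<lambda>x. a * iter_pdiff is h x + iter_pdiff is k x) x
      = a * pdiff i (iter_pdiff is h) x + pdiff i (iter_pdiff is k) x" for x
    by (subst pdiff_eqI[OF has_derivative_add[OF has_derivative_mult_right
          [OF frechet_derivative_works[THEN iffD1]] frechet_derivative_works[THEN iffD1]]])
      (use assms in \<open>auto simp: schwartz_def pdiff_def\<close>)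
  with Cons show ?case by auto
qed simp

lemma schwartz_lincomb:
  assumes "schwartz h" "schwartz k"
  shows "schwartz (\<lambda>x. a * h x + k x)"
proof (rule schwartzI)
  show "iter_pdiff is (\<lambda>x. a * h x + k x) differentiable (at x)" for "is" x
    unfolding iter_pdiff_lincomb[OF assms]
    using assms by (intro differentiable_add differentiable_mult) (auto simp: schwartz_def)
  fix "is" and m :: nat
  obtain C where C: "\<And>x. (1 + norm x) ^ m * norm (iter_pdiff is h x) \<le> C"
    using schwartz_bound[OF assms(1)] by metis
  obtain D where D: "\<And>x. (1 + norm x) ^ m * norm (iter_pdiff is k x) \<le> D"
    using schwartz_bound[OF assms(2)] by metis
  have "(1 + norm x) ^ m * norm (iter_pdiff is (\<lambda>x. a * h x + k x) x) \<le> norm a * C + D" for x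
  proof -
    have "(1 + norm x) ^ m * norm (a * iter_pdiff is h x + iter_pdiff is k x)
       \<le> (1 + norm x) ^ m * (norm a * norm (iter_pdiff is h x) + norm (iter_pdiff is k x))"
      by (intro mult_left_mono norm_triangle_le) (auto simp: norm_mult)
    also have "\<dots> = norm a * ((1 + norm x) ^ m * norm (iter_pdiff is h x))
        + (1 + norm x) ^ m * norm (iter_pdiff is k x)"
      by (simp add: algebra_simps)
    also have "\<dots> \<le> norm a * C + D"
      by (intro add_mono mult_left_mono C D) auto
    finally show ?thesis by (simp add: iter_pdiff_lincomb[OF assms])
  qed
  then show "\<exists>C. \<forall>x. (1 + norm x) ^ m * norm (iter_pdiff is (\<lambda>x. a * h x + k x) x) \<le> C"
    by blast
qed

lemma iter_pdiff_zero: "iter_pdiff is (\<lambda>x. 0) = (\<lambda>x. 0)"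
proof (induction "is")
  case (Cons i "is")
  have "pdiff i (\<lambda>x. 0) = (\<lambda>x. 0)" by (rule ext) (simp add: pdiff_def)
  with Cons show ?case by simp
qed simp

lemma schwartz_zero: "schwartz (\<lambda>x. 0)"
  by (rule schwartzI) (auto simp: iter_pdiff_zero)

lemma schwartz_diff:
  assumes "schwartz h" "schwartz k"
  shows "schwartz (\<lambda>x. h x - k x)"
  using schwartz_lincomb[OF assms(2,1), of "-1"] by simp

lemma schwartz_cmult:
  assumes "schwartz h"
  shows "schwartz (\<lambda>x. a * h x)"
  using schwartz_lincomb[OF assms schwartz_zero, of a] by simp

lemma schwartz_sum:
  assumes "\<And>v. v \<in> A \<Longrightarrow> schwartz (h v)"
  shows "schwartz (\<lambda>x. \<Sum>v\<in>A. a v * h v x)"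
  using assms
proof (induction A rule: infinite_finite_induct)
  case (insert v A)
  then have "schwartz (\<lambda>x. a v * h v x + (\<Sum>v\<in>A. a v * h v x))"
    by (intro schwartz_lincomb) auto
  with insert show ?case by simp
qed (simp_all add: schwartz_zero)

lemma iter_pdiff_sum:
  assumes "\<And>v. v \<in> A \<Longrightarrow> schwartz (h v)"
  shows "iter_pdiff is (\<lambda>x. \<Sum>v\<in>A. a v * h v x) = (\<lambda>x. \<Sum>v\<in>A. a v * iter_pdiff is (h v) x)"
  using assms
proof (induction A rule: infinite_finite_induct)
  case (insert v A)
  then have "iter_pdiff is (\<lambda>x. a v * h v x + (\<Sum>v\<in>A. a v * h v x))
      = (\<lambda>x. a v * iter_pdiff is (h v) x + iter_pdiff is (\<lambda>x. \<Sum>v\<in>A. a v * h v x) x)"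
    by (intro iter_pdiff_lincomb schwartz_sum) auto
  with insert show ?case by simp
qed (simp_all add: iter_pdiff_zero)

text \<open>One chain rule for maps x -> c x + b serves translations (c = 1), reflections (c = -1)
  and the dyadic dilations (b = 0).\<close>

lemma iter_pdiff_affine:
  assumes "schwartz h"
  shows "iter_pdiff is (\<lambda>x. h (c *\<^sub>R x + b))
    = (\<lambda>x. complex_of_real (c ^ length is) * iter_pdiff is h (c *\<^sub>R x + b))"
proof (induction "is")
  case (Cons i "is")
  have "pdiff i (\<lambda>x. complex_of_real (c ^ length is) * iter_pdiff is h (c *\<^sub>R x + b)) x
      = complex_of_real (c ^ Suc (length is)) * pdiff i (iter_pdiff is h) (c *\<^sub>R x + b)" for x
  proof -
    let ?D = "frechet_derivative (iter_pdiff is h) (at (c *\<^sub>R x + b))"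
    have D: "(iter_pdiff is h has_derivative ?D) (at (c *\<^sub>R x + b))"
      using schwartz_differentiable[OF assms] frechet_derivative_works by blast
    have "((\<lambda>x. c *\<^sub>R x + b) has_derivative (\<lambda>h. c *\<^sub>R h)) (at x)"
      by (auto intro!: derivative_eq_intros)
    from has_derivative_mult_right[OF has_derivative_compose[OF this D]]
    have "((\<lambda>x. complex_of_real (c ^ length is) * iter_pdiff is h (c *\<^sub>R x + b))
        has_derivative (\<lambda>h. complex_of_real (c ^ length is) * ?D (c *\<^sub>R h))) (at x)" .
    from pdiff_eqI[OF this, of i] show ?thesis
      by (simp add: linear_scale[OF has_derivative_linear[OF D]] pdiff_def scaleR_conv_of_real[where 'a = complex])
  qed
  with Cons show ?case by auto
qed simp

text \<open>Peetre's inequality: decay at a shifted point is as good as decay at the point itself,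
  at the price of a polynomial factor in the shift.\<close>

lemma weight_shift:
  fixes x y :: "'a::real_normed_vector"
  shows "(1 + norm x) ^ k \<le> (1 + norm (x + y)) ^ k * (1 + norm y) ^ k"
proof -
  have "norm x \<le> norm (x + y) + norm y"
    using norm_triangle_ineq4[of "x + y" y] by simp
  then have "1 + norm x \<le> 1 + norm (x + y) + norm y" by simp
  also have "\<dots> \<le> (1 + norm (x + y)) * (1 + norm y)" by (simp add: algebra_simps)
  finally show ?thesis
    unfolding power_mult_distrib[symmetric] by (intro power_mono) auto
qed

lemma schwartz_affine:
  assumes "schwartz h" "c \<noteq> 0"
  shows "schwartz (\<lambda>x. h (c *\<^sub>R x + b))"
proof (rule schwartzI)
  show "iter_pdiff is (\<lambda>x. h (c *\<^sub>R x + b)) differentiable (at x)" for "is" x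
    unfolding iter_pdiff_affine[OF assms(1)]
  proof (intro differentiable_mult differentiable_const)
    have "(iter_pdiff is h \<circ> (\<lambda>x. c *\<^sub>R x + b)) differentiable (at x)"
      by (intro differentiable_chain_at derivative_intros)
        (auto intro!: differentiable_add differentiable_scaleR schwartz_differentiable[OF assms(1)])
    then show "(\<lambda>x. iter_pdiff is h (c *\<^sub>R x + b)) differentiable (at x)"
      by (simp add: comp_def)
  qed
  fix "is" and k :: nat
  obtain C where C: "\<And>x. (1 + norm x) ^ k * norm (iter_pdiff is h x) \<le> C" "C \<ge> 0"
    using schwartz_bound[OF assms(1)] by metis
  \<comment> \<open>The product (1 + 1/|c|) (1 + |c| |x|) contains both 1 and |x|, so this factor
    works for small and large |c| alike.\<close>
  define e where "e = 1 + 1 / \<bar>c\<bar>"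
  have "(1 + norm x) ^ k * norm (iter_pdiff is (\<lambda>x. h (c *\<^sub>R x + b)) x)
      \<le> e ^ k * (1 + norm b) ^ k * \<bar>c\<bar> ^ length is * C" for x
  proof -
    have "1 + norm x \<le> e * (1 + norm (c *\<^sub>R x))"
      using assms(2) by (simp add: e_def field_simps)
    then have "(1 + norm x) ^ k \<le> (e * (1 + norm (c *\<^sub>R x))) ^ k"
      by (intro power_mono) auto
    also have "\<dots> \<le> e ^ k * ((1 + norm (c *\<^sub>R x + b)) ^ k * (1 + norm b) ^ k)"
      unfolding power_mult_distrib
      by (intro mult_left_mono weight_shift) (auto simp: e_def)
    finally have "(1 + norm x) ^ k \<le> e ^ k * ((1 + norm (c *\<^sub>R x + b)) ^ k * (1 + norm b) ^ k)" .
    then have "(1 + norm x) ^ k * (\<bar>c\<bar> ^ length is * norm (iter_pdiff is h (c *\<^sub>R x + b)))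
       \<le> e ^ k * ((1 + norm (c *\<^sub>R x + b)) ^ k * (1 + norm b) ^ k)
          * (\<bar>c\<bar> ^ length is * norm (iter_pdiff is h (c *\<^sub>R x + b)))"
      by (intro mult_right_mono) auto
    also have "\<dots> = e ^ k * (1 + norm b) ^ k * \<bar>c\<bar> ^ length is *
        ((1 + norm (c *\<^sub>R x + b)) ^ k * norm (iter_pdiff is h (c *\<^sub>R x + b)))"
      by (simp add: algebra_simps)
    also have "\<dots> \<le> e ^ k * (1 + norm b) ^ k * \<bar>c\<bar> ^ length is * C"
      by (intro mult_left_mono C) (auto simp: e_def)
    finally show ?thesis
      by (simp add: iter_pdiff_affine[OF assms(1)] norm_mult norm_power)
  qed
  then show "\<exists>C. \<forall>x. (1 + norm x) ^ k * norm (iter_pdiff is (\<lambda>x. h (c *\<^sub>R x + b)) x) \<le> C"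
    by blast
qed

lemma schwartz_translate: "schwartz h \<Longrightarrow> schwartz (\<lambda>x. h (x + b))"
  using schwartz_affine[of h 1 b] by simp

lemma iter_pdiff_translate:
  "schwartz h \<Longrightarrow> iter_pdiff is (\<lambda>x. h (x + b)) = (\<lambda>x. iter_pdiff is h (x + b))"
  using iter_pdiff_affine[of h "is" 1 b] by simp

lemma schwartz_reflect: "schwartz h \<Longrightarrow> schwartz (\<lambda>y. h (x - y))"
  using schwartz_affine[of h "-1" x] by simp

text \<open>The weight sits at y while the difference is taken between y + v and y + w. Points of
  the segment from v to w have norm at most |v| + |w|, so \<open>weight_shift\<close> costs only the
  factor in v and w. With w fixed and v an approximation of it, the estimate is uniform in y, as
  convergence in the Schwartz seminorms requires.\<close>

lemma schwartz_mean_value: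
  fixes h :: "real^'n::finite \<Rightarrow> complex"
  assumes "schwartz h"
  obtains C where "C \<ge> 0"
    "\<And>y v w. (1 + norm y) ^ k * norm (iter_pdiff is h (y + v) - iter_pdiff is h (y + w))
        \<le> C * (1 + norm v + norm w) ^ k * norm (v - w)"
proof -
  have "\<forall>i. \<exists>C\<ge>0. \<forall>x. (1 + norm x) ^ k * norm (pdiff i (iter_pdiff is h) x) \<le> C"
    using schwartz_bound[OF assms, of k "_ # is"] by (metis iter_pdiff.simps(2))
  then obtain C where C: "\<And>i. C i \<ge> 0"
    "\<And>i x. (1 + norm x) ^ k * norm (pdiff i (iter_pdiff is h) x) \<le> C i"
    by metis
  have "(1 + norm y) ^ k * norm (iter_pdiff is h (y + v) - iter_pdiff is h (y + w))
      \<le> (\<Sum>i\<in>UNIV. C i) * (1 + norm v + norm w) ^ k * norm (v - w)" for y v w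
  proof -
    let ?S = "closed_segment (y + v) (y + w)"
    let ?B = "(\<Sum>i\<in>UNIV. C i) * (1 + norm v + norm w) ^ k / (1 + norm y) ^ k"
    have "norm (iter_pdiff is h (y + v) - iter_pdiff is h (y + w)) \<le> ?B * norm ((y + v) - (y + w))"
    proof (rule differentiable_bound[where S = ?S])
      show "(iter_pdiff is h has_derivative
           (\<lambda>d. \<Sum>i\<in>UNIV. (d $ i) *\<^sub>R pdiff i (iter_pdiff is h) x)) (at x within ?S)" for x
        by (rule has_derivative_at_withinI[OF has_derivative_pdiff[OF schwartz_differentiable[OF assms]]])
      fix x assume "x \<in> ?S"
      then obtain u where u: "u \<in> closed_segment v w" "x = y + u"
        using closed_segment_translation[of y v w] by auto
      then obtain s where s: "0 \<le> s" "s \<le> 1" "u = (1 - s) *\<^sub>R v + s *\<^sub>R w"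
        by (auto simp: closed_segment_def)
      have "norm u \<le> (1 - s) * norm v + s * norm w"
        using s norm_triangle_ineq[of "(1 - s) *\<^sub>R v" "s *\<^sub>R w"] by simp
      also have "\<dots> \<le> 1 * norm v + 1 * norm w"
        using s by (intro add_mono mult_right_mono) auto
      finally have nu: "norm u \<le> norm v + norm w" by simp
      have "norm (pdiff i (iter_pdiff is h) x) \<le> C i * (1 + norm v + norm w) ^ k / (1 + norm y) ^ k" for i
      proof -
        let ?p = "norm (pdiff i (iter_pdiff is h) x)"
        have "(1 + norm y) ^ k * ?p \<le> ((1 + norm x) ^ k * (1 + norm u) ^ k) * ?p"
          using weight_shift[of y k u] u by (intro mult_right_mono) auto
        also have "\<dots> = (1 + norm u) ^ k * ((1 + norm x) ^ k * ?p)" by simp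
        also have "\<dots> \<le> (1 + norm v + norm w) ^ k * C i"
          using nu by (intro mult_mono power_mono C) auto
        finally show ?thesis by (simp add: field_simps add_pos_nonneg)
      qed
      then have "(\<Sum>i\<in>UNIV. norm (pdiff i (iter_pdiff is h) x)) \<le> ?B"
        unfolding sum_distrib_right sum_divide_distrib by (intro sum_mono)
      with onorm_gradient_le
      show "onorm (\<lambda>d. \<Sum>i\<in>UNIV. (d $ i) *\<^sub>R pdiff i (iter_pdiff is h) x) \<le> ?B"
        by (rule order_trans)
    qed auto
    then show ?thesis by (simp add: field_simps add_pos_nonneg)
  qed
  then show thesis
    using that[of "\<Sum>i\<in>UNIV. C i"] C(1) by (simp add: sum_nonneg)
qed

text \<open>The first derivatives are globally Lipschitz by the mean value estimate with k = 0, so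
  the first-order remainder is quadratic with one constant for all y. Uniformity in y is what
  survives integration in \<open>has_derivative_corr\<close>.\<close>

lemma schwartz_taylor:
  fixes h :: "real^'n::finite \<Rightarrow> complex"
  assumes "schwartz h"
  obtains C where "C \<ge> 0"
    "\<And>y d. norm (h (y + d) - h y - (\<Sum>i\<in>UNIV. (d $ i) *\<^sub>R pdiff i h y)) \<le> C * (norm d)\<^sup>2"
proof -
  have "\<forall>i. \<exists>C\<ge>0. \<forall>y v. norm (pdiff i h (y + v) - pdiff i h y) \<le> C * norm v"
  proof
    fix i
    obtain C where "C \<ge> 0"
      "\<And>y v w. (1 + norm y) ^ 0 * norm (iter_pdiff [i] h (y + v) - iter_pdiff [i] h (y + w))
          \<le> C * (1 + norm v + norm w) ^ 0 * norm (v - w)"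
      using schwartz_mean_value[OF assms] by blast
    note C = this(1) this(2)[of _ _ 0]
    then show "\<exists>C\<ge>0. \<forall>y v. norm (pdiff i h (y + v) - pdiff i h y) \<le> C * norm v"
      by (intro exI[of _ C]) auto
  qed
  then obtain C where C: "\<And>i. C i \<ge> 0"
    "\<And>i y v. norm (pdiff i h (y + v) - pdiff i h y) \<le> C i * norm v"
    by metis
  have "norm (h (y + d) - h y - (\<Sum>i\<in>UNIV. (d $ i) *\<^sub>R pdiff i h y)) \<le> (\<Sum>i\<in>UNIV. C i) * (norm d)\<^sup>2"
    for y d
  proof -
    let ?f' = "\<lambda>x d. \<Sum>i\<in>UNIV. ((d::real^'n) $ i) *\<^sub>R pdiff i h x"
    have "norm (h (y + d) - h y - ?f' y ((y + d) - y)) \<le> norm ((y + d) - y) * ((\<Sum>i\<in>UNIV. C i) * norm d)"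
    proof (rule differentiable_bound_linearization[where S = "cball y (norm d)"])
      show "y + t *\<^sub>R (y + d - y) \<in> cball y (norm d)" if "t \<in> {0..1}" for t
        using that by (auto simp: dist_norm mult_left_le_one_le)
      show "(h has_derivative ?f' x) (at x within cball y (norm d))" for x
        using has_derivative_at_withinI[OF has_derivative_pdiff[OF schwartz_differentiable[OF assms, of "[]"]]]
        by simp
      fix x assume "x \<in> cball y (norm d)"
      then have nx: "norm (x - y) \<le> norm d" by (simp add: dist_norm norm_minus_commute)
      have eq: "?f' x - ?f' y = (\<lambda>d. \<Sum>i\<in>UNIV. (d $ i) *\<^sub>R (pdiff i h x - pdiff i h y))"
        by (auto simp: fun_eq_iff sum_subtractf scaleR_diff_right)
      have "norm (pdiff i h x - pdiff i h y) \<le> C i * norm d" for i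
        using C(2)[of i y "x - y"] mult_left_mono[OF nx C(1)[of i]] by simp
      then have "(\<Sum>i\<in>UNIV. norm (pdiff i h x - pdiff i h y)) \<le> (\<Sum>i\<in>UNIV. C i) * norm d"
        unfolding sum_distrib_right by (intro sum_mono)
      with onorm_gradient_le
      show "onorm (?f' x - ?f' y) \<le> (\<Sum>i\<in>UNIV. C i) * norm d"
        unfolding eq by (rule order_trans)
    qed auto
    then show ?thesis by (simp add: power2_eq_square algebra_simps)
  qed
  then show thesis
    using that[of "\<Sum>i\<in>UNIV. C i"] C(1) by (simp add: sum_nonneg)
qed

section \<open>Integrability and correlation\<close>

lemma ennreal_term_le_suminf: "(t :: nat \<Rightarrow> ennreal) m \<le> suminf t"
  using sum_le_suminf[of t "{m}"] by simp

text \<open>The integrand is dominated by constants on the balls of radius 2^m: if m is least with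
  |x| \<le> 2^m, then 2^m / 2 \<le> 1 + |x|. With n the dimension, volume 2^(mn) against height
  2^(-m(n+1)) leaves the geometric series of ratio 1/2.\<close>

lemma integrable_inverse_weight:
  "integrable lborel (\<lambda>x::'a::euclidean_space. 1 / (1 + norm x) ^ Suc DIM('a))"
proof (rule integrableI_nonneg)
  let ?n = "DIM('a)"
  let ?V = "unit_ball_vol (real ?n)"
  have "(\<integral>\<^sup>+(x::'a). ennreal (1 / (1 + norm x) ^ Suc ?n) \<partial>lborel)
      \<le> (\<integral>\<^sup>+(x::'a). (\<Sum>m. ennreal (2 ^ Suc ?n / (2 ^ m) ^ Suc ?n) * indicator (cball 0 (2 ^ m)) x) \<partial>lborel)"
  proof (rule nn_integral_mono)
    fix x :: 'a
    let ?t = "\<lambda>m. ennreal (2 ^ Suc ?n / (2 ^ m) ^ Suc ?n) * indicator (cball 0 (2 ^ m)) x"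
    define m where "m = (LEAST m. norm x \<le> 2 ^ m)"
    have "\<exists>m. norm x \<le> 2 ^ m"
      using real_arch_pow[of 2 "norm x"] by (auto intro: less_imp_le)
    then have m: "norm x \<le> 2 ^ m"
      unfolding m_def by (rule LeastI_ex)
    have "2 ^ m / 2 \<le> 1 + norm x"
    proof (cases m)
      case (Suc l)
      then have "\<not> norm x \<le> 2 ^ l"
        using not_less_Least[of l "\<lambda>m. norm x \<le> 2 ^ m"] by (simp add: m_def)
      with Suc show ?thesis by simp
    qed (simp add: add_increasing2)
    then have "(2 ^ m / 2) ^ Suc ?n \<le> (1 + norm x) ^ Suc ?n"
      by (intro power_mono) auto
    then have "1 / (1 + norm x) ^ Suc ?n \<le> 1 / (2 ^ m / 2) ^ Suc ?n"
      by (intro divide_left_mono) (auto simp: add_pos_nonneg)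
    also have "\<dots> = 2 ^ Suc ?n / (2 ^ m) ^ Suc ?n"
      unfolding power_divide by (simp del: power_Suc)
    finally have "ennreal (1 / (1 + norm x) ^ Suc ?n) \<le> ?t m"
      using m by (simp add: ennreal_leI del: power_Suc)
    also have "\<dots> \<le> (\<Sum>m. ?t m)"
      by (rule ennreal_term_le_suminf)
    finally show "ennreal (1 / (1 + norm x) ^ Suc ?n) \<le> (\<Sum>m. ?t m)" .
  qed
  also have "\<dots> = (\<Sum>m. ennreal (2 ^ Suc ?n / (2 ^ m) ^ Suc ?n) * emeasure lborel (cball (0::'a) (2 ^ m)))"
    by (subst nn_integral_suminf)
      (auto simp: nn_integral_cmult_indicator intro!: borel_measurable_times_ennreal borel_measurable_indicator)
  also have "\<dots> = (\<Sum>m. ennreal (2 ^ Suc ?n * ?V * (1 / 2) ^ m))"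
    by (intro suminf_cong)
      (simp add: emeasure_cball ennreal_mult'[symmetric] power_divide field_simps)
  also have "\<dots> = ennreal (\<Sum>m. 2 ^ Suc ?n * ?V * (1 / 2) ^ m)"
    by (intro suminf_ennreal2) (auto intro!: summable_mult summable_geometric)
  also have "\<dots> < \<infinity>" by simp
  finally show "(\<integral>\<^sup>+(x::'a). ennreal (1 / (1 + norm x) ^ Suc ?n) \<partial>lborel) < \<infinity>" .
qed auto

lemma schwartz_integrable_weight:
  fixes g :: "real^'n::finite \<Rightarrow> complex"
  assumes "schwartz g"
  shows "integrable lborel (\<lambda>x. (1 + norm x) ^ k * norm (g x))"
proof -
  define N where "N = Suc DIM(real^'n)"
  obtain C where C: "C \<ge> 0" "\<And>x. (1 + norm x) ^ (k + N) * norm (g x) \<le> C"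
    using schwartz_bound[OF assms, of "k + N" "[]"] by auto
  show ?thesis
  proof (rule Bochner_Integration.integrable_bound)
    show "integrable lborel (\<lambda>x::real^'n. C * (1 / (1 + norm x) ^ N))"
      unfolding N_def by (intro integrable_mult_right integrable_inverse_weight)
    show "(\<lambda>x. (1 + norm x) ^ k * norm (g x)) \<in> borel_measurable lborel"
      using schwartz_borel_measurable[OF assms] by measurable
    have "norm ((1 + norm x) ^ k * norm (g x)) \<le> norm (C * (1 / (1 + norm x) ^ N))" for x
      using C(2)[of x] C(1) by (simp add: power_add field_simps add_pos_nonneg abs_mult del: power_Suc)
    then show "AE x in lborel. norm ((1 + norm x) ^ k * norm (g x)) \<le> norm (C * (1 / (1 + norm x) ^ N))"
      by simp
  qed
qed

lemma schwartz_integrable: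
  assumes "schwartz g"
  shows "integrable lborel g"
  using schwartz_integrable_weight[OF assms, of 0] schwartz_borel_measurable[OF assms]
  by (simp add: integrable_iff_bounded)

lemma schwartz_bounded:
  assumes "schwartz h"
  obtains C where "C \<ge> 0" "\<And>x. norm (iter_pdiff is h x) \<le> C"
  using schwartz_bound[OF assms, of 0 "is"] by auto

text \<open>The map s is arbitrary so that the lemma covers both y + w and its discretisation y + F
  i w.\<close>

lemma integrable_mult_schwartz:
  assumes "integrable lborel g" "schwartz h" "s \<in> borel_measurable borel"
  shows "integrable lborel (\<lambda>w. g w * iter_pdiff is h (s w))"
proof -
  obtain C where C: "C \<ge> 0" "\<And>x. norm (iter_pdiff is h x) \<le> C"
    using schwartz_bounded[OF assms(2)] by metis
  have [measurable]: "iter_pdiff is h \<in> borel_measurable borel" "s \<in> borel_measurable borel"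
    "g \<in> borel_measurable borel"
    using assms iter_pdiff_borel_measurable by auto
  show ?thesis
  proof (rule Bochner_Integration.integrable_bound)
    show "integrable lborel (\<lambda>w. C * norm (g w))"
      using assms(1) by auto
    have "norm (g w * iter_pdiff is h (s w)) \<le> norm (C * norm (g w))" for w
      using mult_right_mono[OF C(2)[of "s w"] norm_ge_zero[of "g w"]] C(1)
      by (simp add: norm_mult abs_mult mult.commute)
    then show "AE w in lborel. norm (g w * iter_pdiff is h (s w)) \<le> norm (C * norm (g w))"
      by simp
  qed measurable
qed

text \<open>Correlation with g, the adjoint of convolution with g: the distribution f * g sends h to
  \<open>f (corr g h)\<close>. It is also the average of the translates of h with weights g w, which
  is how sup bounds pass through it.\<close>

definition corr :: "(real^'n::finite \<Rightarrow> complex) \<Rightarrow> (real^'n \<Rightarrow> complex) \<Rightarrow> real^'n \<Rightarrow> complex" where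
  "corr g h y = (LINT w|lborel. g w * h (y + w))"

text \<open>Differentiation under the integral: by \<open>schwartz_taylor\<close> the integrated
  remainder is at most a constant times the L^1 norm of g times |d|^2. All derivatives fall on
  h.\<close>

lemma has_derivative_corr:
  fixes g h :: "real^'n::finite \<Rightarrow> complex"
  assumes g: "integrable lborel g" and h: "schwartz h"
  shows "(corr g h has_derivative (\<lambda>d. \<Sum>i\<in>UNIV. (d $ i) *\<^sub>R corr g (pdiff i h) y)) (at y)"
proof -
  obtain C where C: "C \<ge> 0"
    "\<And>y d. norm (h (y + d) - h y - (\<Sum>i\<in>UNIV. (d $ i) *\<^sub>R pdiff i h y)) \<le> C * (norm d)\<^sup>2"
    using schwartz_taylor[OF h] by blast
  let ?G = "LINT w|lborel. norm (g w)"
  have int0: "integrable lborel (\<lambda>w. g w * h (y + w))" for y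
    using integrable_mult_schwartz[OF g h, of "\<lambda>w. y + w" "[]"] by simp
  have int1: "integrable lborel (\<lambda>w. g w * pdiff i h (y + w))" for y i
    using integrable_mult_schwartz[OF g h, of "\<lambda>w. y + w" "[i]"] by simp
  have main: "norm (corr g h (y + d) - corr g h y - (\<Sum>i\<in>UNIV. (d $ i) *\<^sub>R corr g (pdiff i h) y))
      \<le> C * ?G * (norm d)\<^sup>2" for d
  proof -
    have "corr g h (y + d) - corr g h y - (\<Sum>i\<in>UNIV. (d $ i) *\<^sub>R corr g (pdiff i h) y)
        = (LINT w|lborel. g w * h (y + d + w) - g w * h (y + w)
             - (\<Sum>i\<in>UNIV. (d $ i) *\<^sub>R (g w * pdiff i h (y + w))))"
      using int0 int1 by (simp add: corr_def)
    also have "\<dots> = (LINT w|lborel. g w * (h (y + w + d) - h (y + w)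
             - (\<Sum>i\<in>UNIV. (d $ i) *\<^sub>R pdiff i h (y + w))))"
      by (simp add: algebra_simps sum_distrib_left)
    also have "norm \<dots> \<le> (LINT w|lborel. norm (g w) * (C * (norm d)\<^sup>2))"
    proof (rule Bochner_Integration.integral_norm_bound_integral)
      have "integrable lborel (\<lambda>w. g w * h (y + d + w) - g w * h (y + w)
             - (\<Sum>i\<in>UNIV. (d $ i) *\<^sub>R (g w * pdiff i h (y + w))))"
        using int0 int1 by auto
      then show "integrable lborel (\<lambda>w. g w * (h (y + w + d) - h (y + w)
             - (\<Sum>i\<in>UNIV. (d $ i) *\<^sub>R pdiff i h (y + w))))"
        by (simp add: algebra_simps sum_distrib_left)
      show "integrable lborel (\<lambda>w. norm (g w) * (C * (norm d)\<^sup>2))"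
        using g by auto
    qed (auto simp: norm_mult intro!: mult_left_mono C)
    finally show ?thesis by (simp add: mult_ac)
  qed
  show ?thesis
  proof (rule has_derivativeI_sandwich[of 1])
    show "bounded_linear (\<lambda>d. \<Sum>i\<in>UNIV. (d $ i) *\<^sub>R corr g (pdiff i h) y)"
      by (intro bounded_linear_sum bounded_linear_scaleR_const bounded_linear_vec_nth)
    show "norm (corr g h z - corr g h y - (\<Sum>i\<in>UNIV. ((z - y) $ i) *\<^sub>R corr g (pdiff i h) y))
        / norm (z - y) \<le> C * ?G * norm (z - y)" if "z \<noteq> y" for z
      using main[of "z - y"] that by (simp add: field_simps power2_eq_square)
    show "((\<lambda>z. C * ?G * norm (z - y)) \<longlongrightarrow> 0) (at y)"
      by (auto intro!: tendsto_eq_intros)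
  qed auto
qed

lemma pdiff_corr:
  assumes "integrable lborel g" "schwartz h"
  shows "pdiff i (corr g h) = corr g (pdiff i h)"
proof
  fix y
  have "pdiff i (corr g h) y = (\<Sum>j\<in>UNIV. (axis i 1 $ j) *\<^sub>R corr g (pdiff j h) y)"
    by (rule pdiff_eqI[OF has_derivative_corr[OF assms]])
  also have "\<dots> = (\<Sum>j\<in>UNIV. if j = i then corr g (pdiff j h) y else 0)"
    by (rule sum.cong) (auto simp: axis_def)
  finally show "pdiff i (corr g h) y = corr g (pdiff i h) y" by simp
qed

lemma iter_pdiff_corr:
  assumes "integrable lborel g" "schwartz h"
  shows "iter_pdiff is (corr g h) = corr g (iter_pdiff is h)"
  by (induction "is") (auto simp: pdiff_corr[OF assms(1) schwartz_iter_pdiff[OF assms(2)]])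

text \<open>\<open>weight_shift\<close> splits the weight at y into one at y + w, absorbed by h, and
  one at w, absorbed by g. The bound is linear in C with a factor depending on g and k alone, so it
  yields continuity in the seminorms as well as rapid decay.\<close>

lemma corr_weight_bound:
  fixes g h :: "real^'n::finite \<Rightarrow> complex"
  assumes g: "schwartz g" and h: "schwartz h" and C: "\<And>x. (1 + norm x) ^ k * norm (iter_pdiff is h x) \<le> C"
  shows "(1 + norm y) ^ k * norm (corr g (iter_pdiff is h) y)
    \<le> (LINT w|lborel. (1 + norm w) ^ k * norm (g w)) * C"
proof -
  let ?h = "iter_pdiff is h"
  note gi = schwartz_integrable[OF g]
  have "(1 + norm y) ^ k * norm (corr g ?h y) = norm (LINT w|lborel. (1 + norm y) ^ k *\<^sub>R (g w * ?h (y + w)))"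
    by (simp add: corr_def norm_mult norm_power)
  also have "\<dots> \<le> (LINT w|lborel. ((1 + norm w) ^ k * norm (g w)) * C)"
  proof (rule Bochner_Integration.integral_norm_bound_integral)
    show "integrable lborel (\<lambda>w. (1 + norm y) ^ k *\<^sub>R (g w * ?h (y + w)))"
      by (intro integrable_scaleR_right integrable_mult_schwartz gi h) simp
    show "integrable lborel (\<lambda>w. ((1 + norm w) ^ k * norm (g w)) * C)"
      using schwartz_integrable_weight[OF g] by (rule integrable_mult_left)
    fix w
    have "norm ((1 + norm y) ^ k *\<^sub>R (g w * ?h (y + w))) = (1 + norm y) ^ k * (norm (g w) * norm (?h (y + w)))"
      by (simp add: norm_mult)
    also have "\<dots> \<le> (1 + norm (y + w)) ^ k * (1 + norm w) ^ k * (norm (g w) * norm (?h (y + w)))"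
      by (intro mult_right_mono weight_shift) auto
    also have "\<dots> = ((1 + norm w) ^ k * norm (g w)) * ((1 + norm (y + w)) ^ k * norm (?h (y + w)))"
      by (simp add: mult_ac)
    also have "\<dots> \<le> ((1 + norm w) ^ k * norm (g w)) * C"
      by (intro mult_left_mono C) auto
    finally show "norm ((1 + norm y) ^ k *\<^sub>R (g w * ?h (y + w))) \<le> ((1 + norm w) ^ k * norm (g w)) * C" .
  qed
  finally show ?thesis by simp
qed

lemma schwartz_corr:
  assumes "schwartz g" "schwartz h"
  shows "schwartz (corr g h)"
proof (rule schwartzI)
  note g = schwartz_integrable[OF assms(1)]
  show "iter_pdiff is (corr g h) differentiable (at x)" for "is" x
    using has_derivative_corr[OF g schwartz_iter_pdiff[OF assms(2)]]
    by (auto simp: iter_pdiff_corr[OF g assms(2)] differentiable_def)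
  fix "is" and k :: nat
  obtain C where C: "\<And>x. (1 + norm x) ^ k * norm (iter_pdiff is h x) \<le> C"
    using schwartz_bound[OF assms(2)] by metis
  show "\<exists>C. \<forall>x. (1 + norm x) ^ k * norm (iter_pdiff is (corr g h) x) \<le> C"
    unfolding iter_pdiff_corr[OF g assms(2)] using corr_weight_bound[OF assms C] by blast
qed

section \<open>Seminorm estimates\<close>

lemma schwartz_bdd_above:
  "schwartz h \<Longrightarrow> bdd_above (range (\<lambda>x. (1 + norm x) ^ k * norm (iter_pdiff is h x)))"
  by (simp add: schwartz_def bounded_imp_bdd_above)

lemma schwartz_seminorm_upper:
  assumes "schwartz h"
  shows "(1 + norm x) ^ k * norm (iter_pdiff is h x) \<le> (SUP x. (1 + norm x) ^ k * norm (iter_pdiff is h x))"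
  by (rule cSUP_upper[OF UNIV_I schwartz_bdd_above[OF assms]])

text \<open>Guards against the default value 0 of an infinite sum in
  \<open>schwartz_seminorm\<close>, and licenses its monotonicity in the order.\<close>

lemma finite_multi_indices: "finite {is::'n::finite list. length is \<le> N}"
  using finite_lists_length_le[of "UNIV :: 'n set" N] by simp

lemma schwartz_seminorm_mono:
  assumes "schwartz (h :: real^'n::finite \<Rightarrow> complex)" "M \<le> N"
  shows "schwartz_seminorm M h \<le> schwartz_seminorm N h"
proof -
  have nonneg: "0 \<le> (SUP x. (1 + norm x) ^ k * norm (iter_pdiff is h x))" for k "is"
    using schwartz_seminorm_upper[OF assms(1), of 0 k "is"] by (rule order_trans[rotated]) simp
  have "schwartz_seminorm M h \<le> (\<Sum>is\<in>{is::'n list. length is \<le> M}. \<Sum>k\<le>N.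
      (SUP x. (1 + norm x) ^ k * norm (iter_pdiff is h x)))"
    unfolding schwartz_seminorm_def
    by (intro sum_mono sum_mono2) (use assms(2) nonneg in auto)
  also have "\<dots> \<le> schwartz_seminorm N h"
    unfolding schwartz_seminorm_def
    by (intro sum_mono2 finite_multi_indices sum_nonneg nonneg) (use assms(2) in auto)
  finally show ?thesis .
qed

text \<open>Continuity of correlation on the Schwartz space, which makes \<open>low_pass\<close>
  tempered. Summing the moments of |g| up to order N gives one constant for all the terms of the
  seminorm.\<close>

lemma schwartz_seminorm_corr:
  fixes g :: "real^'n::finite \<Rightarrow> complex"
  assumes "schwartz g"
  obtains B where "B \<ge> 0" "\<And>h. schwartz h \<Longrightarrow> schwartz_seminorm N (corr g h) \<le> B * schwartz_seminorm N h"
proof -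
  let ?G = "\<lambda>k. LINT w|lborel. (1 + norm w) ^ k * norm (g w)"
  have G0: "?G k \<ge> 0" for k by (rule Bochner_Integration.integral_nonneg) auto
  have "schwartz_seminorm N (corr g h) \<le> (\<Sum>k\<le>N. ?G k) * schwartz_seminorm N h" if h: "schwartz h" for h
  proof -
    let ?s = "\<lambda>h is k. SUP x. (1 + norm x) ^ k * norm (iter_pdiff is h x)"
    have pos: "0 \<le> ?s h is k" for "is" k
      using schwartz_seminorm_upper[OF h, of 0 k "is"] by (rule order_trans[rotated]) simp
    have "?s (corr g h) is k \<le> (\<Sum>k\<le>N. ?G k) * ?s h is k" if "k \<le> N" for "is" k
    proof (rule cSUP_least)
      fix x
      have "(1 + norm x) ^ k * norm (iter_pdiff is (corr g h) x) \<le> ?G k * ?s h is k"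
        unfolding iter_pdiff_corr[OF schwartz_integrable[OF assms] h]
        by (rule corr_weight_bound[OF assms h schwartz_seminorm_upper[OF h]])
      also have "\<dots> \<le> (\<Sum>k\<le>N. ?G k) * ?s h is k"
        using that by (intro mult_right_mono member_le_sum pos G0) auto
      finally show "(1 + norm x) ^ k * norm (iter_pdiff is (corr g h) x) \<le> (\<Sum>k\<le>N. ?G k) * ?s h is k" .
    qed simp
    then show ?thesis
      unfolding schwartz_seminorm_def sum_distrib_left by (intro sum_mono) auto
  qed
  then show thesis using that[of "\<Sum>k\<le>N. ?G k"] G0 by (simp add: sum_nonneg)
qed

section \<open>Tempered distributions and averages of translates\<close>

lemma tempered_linear:
  "tempered f \<Longrightarrow> schwartz h \<Longrightarrow> schwartz k \<Longrightarrow> f (\<lambda>x. a * h x + k x) = a * f h + f k"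
  unfolding tempered_def by blast

lemma tempered_zero: "tempered f \<Longrightarrow> f (\<lambda>x. 0) = 0"
  using tempered_linear[OF _ schwartz_zero schwartz_zero, of f 1] by simp

lemma tempered_diff:
  assumes "tempered f" "schwartz h" "schwartz k"
  shows "f (\<lambda>x. h x - k x) = f h - f k"
  using tempered_linear[OF assms(1,3,2), of "-1"] by simp

lemma tempered_sum:
  assumes "tempered f" "\<And>v. v \<in> A \<Longrightarrow> schwartz (h v)"
  shows "f (\<lambda>x. \<Sum>v\<in>A. a v * h v x) = (\<Sum>v\<in>A. a v * f (h v))"
  using assms(2)
proof (induction A rule: infinite_finite_induct)
  case (insert v A)
  then have "f (\<lambda>x. a v * h v x + (\<Sum>v\<in>A. a v * h v x)) = a v * f (h v) + f (\<lambda>x. \<Sum>v\<in>A. a v * h v x)"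
    by (intro tempered_linear[OF assms(1)] schwartz_sum) auto
  with insert show ?case by simp
qed (simp_all add: tempered_zero[OF assms(1)])

lemma tempered_bound:
  assumes "tempered f"
  obtains C N where "C \<ge> 0" "\<And>h. schwartz h \<Longrightarrow> norm (f h) \<le> C * schwartz_seminorm N h"
proof -
  obtain C N where C: "\<And>h. schwartz h \<Longrightarrow> norm (f h) \<le> C * schwartz_seminorm N h"
    using assms unfolding tempered_def by blast
  have "norm (f h) \<le> \<bar>C\<bar> * schwartz_seminorm N h" if h: "schwartz h" for h
  proof -
    have "schwartz_seminorm N h \<ge> 0"
      unfolding schwartz_seminorm_def
      by (intro sum_nonneg order_trans[OF _ schwartz_seminorm_upper[OF h, of 0]]) simp
    then have "C * schwartz_seminorm N h \<le> \<bar>C\<bar> * schwartz_seminorm N h"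
      by (intro mult_right_mono) auto
    with C[OF h] show ?thesis by linarith
  qed
  then show thesis using that[of "\<bar>C\<bar>" N] by simp
qed

text \<open>The pairing with f is moved inside the integral over w by replacing \<open>h (y + w)\<close> with
  \<open>h (y + F i w)\<close> for simple functions \<open>F i w \<longlonglongrightarrow> w\<close>: the integral becomes a finite linear
  combination of translates of h, and these converge in the Schwartz seminorms.\<close>
lemma tempered_corr_bound:
  fixes f :: "(real^'n::finite \<Rightarrow> complex) \<Rightarrow> complex"
  assumes f: "tempered f" and g: "schwartz g" and h: "schwartz h"
    and S: "\<And>v. norm (f (\<lambda>y. h (y + v))) \<le> S"
  shows "norm (f (corr g h)) \<le> (LINT w|lborel. norm (g w)) * S"
proof -
  note gi = schwartz_integrable[OF g]
  note [measurable] = schwartz_borel_measurable[OF g]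
  \<comment> \<open>The approximations are taken relative to the base point 0; the bound 2 |x|
    supplies the domination used below.\<close>
  obtain F :: "nat \<Rightarrow> real^'n \<Rightarrow> real^'n" where F: "\<And>i. simple_function borel (F i)"
    "\<And>x. (\<lambda>i. F i x) \<longlonglongrightarrow> x" "\<And>i x. norm (F i x) \<le> 2 * norm x"
    using borel_measurable_implies_sequence_metric[of "\<lambda>x::real^'n. x" borel 0] by auto
  have [measurable]: "F i \<in> borel_measurable borel" for i
    by (rule borel_measurable_simple_function[OF F(1)])
  define R where "R i = range (F i)" for i
  have fin: "finite (R i)" for i
    using F(1)[of i] by (simp add: simple_function_def R_def)
  have [measurable]: "{w. F i w = v} \<in> sets borel" for i v
    by measurable
  let ?I = "\<lambda>i v w. if F i w = v then g w else 0"
  \<comment> \<open>The mass of g on the level set where F i equals v. A level set may have infinite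
    measure, but g is integrable, so all these masses are finite.\<close>
  define c where "c i v = (LINT w|lborel. ?I i v w)" for i v
  have Ii: "integrable lborel (?I i v)" for i v
    by (rule Bochner_Integration.integrable_bound[OF gi]) auto
  define \<psi> where "\<psi> i y = (\<Sum>v\<in>R i. c i v * h (y + v))" for i y
  have D\<psi>: "iter_pdiff is (\<psi> i) y = (LINT w|lborel. g w * iter_pdiff is h (y + F i w))" for "is" i y
  proof -
    have "iter_pdiff is (\<psi> i) y = (\<Sum>v\<in>R i. c i v * iter_pdiff is h (y + v))"
      unfolding \<psi>_def
      by (subst iter_pdiff_sum) (auto simp: schwartz_translate[OF h] iter_pdiff_translate[OF h])
    also have "\<dots> = (LINT w|lborel. (\<Sum>v\<in>R i. ?I i v w * iter_pdiff is h (y + v)))"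
      unfolding c_def
      by (subst Bochner_Integration.integral_sum)
        (auto intro!: sum.cong integral_mult_left_zero[symmetric] integrable_mult_left Ii simp del: if_split)
    also have "(\<lambda>w. \<Sum>v\<in>R i. ?I i v w * iter_pdiff is h (y + v)) = (\<lambda>w. g w * iter_pdiff is h (y + F i w))"
    proof
      fix w
      have "(\<Sum>v\<in>R i. ?I i v w * iter_pdiff is h (y + v))
          = (\<Sum>v\<in>R i. if v = F i w then g w * iter_pdiff is h (y + v) else 0)"
        by (rule sum.cong) auto
      then show "(\<Sum>v\<in>R i. ?I i v w * iter_pdiff is h (y + v)) = g w * iter_pdiff is h (y + F i w)"
        using fin by (simp add: R_def)
    qed
    finally show ?thesis .
  qed
  have \<psi>: "schwartz (\<psi> i)" for i
    unfolding \<psi>_def by (intro schwartz_sum schwartz_translate h)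
  have f\<psi>: "norm (f (\<psi> i)) \<le> (LINT w|lborel. norm (g w)) * S" for i
  proof -
    have "f (\<psi> i) = (\<Sum>v\<in>R i. c i v * f (\<lambda>y. h (y + v)))"
      unfolding \<psi>_def by (rule tempered_sum[OF f schwartz_translate[OF h]])
    also have "norm \<dots> \<le> (\<Sum>v\<in>R i. norm (c i v) * S)"
      by (intro sum_norm_le) (simp add: norm_mult mult_left_mono S)
    also have "\<dots> = (\<Sum>v\<in>R i. norm (c i v)) * S"
      by (simp add: sum_distrib_right)
    also have "\<dots> \<le> (LINT w|lborel. norm (g w)) * S"
    proof (rule mult_right_mono)
      show "S \<ge> 0" using S[of 0] norm_ge_zero order_trans by blast
      \<comment> \<open>The level sets partition the space, so the masses add up to at most the L^1
        norm of g, whatever i is.\<close>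
      have "(\<Sum>v\<in>R i. norm (c i v)) \<le> (\<Sum>v\<in>R i. LINT w|lborel. norm (?I i v w))"
        unfolding c_def by (intro sum_mono integral_norm_bound)
      also have "\<dots> = (LINT w|lborel. (\<Sum>v\<in>R i. norm (?I i v w)))"
        by (rule Bochner_Integration.integral_sum[symmetric]) (intro integrable_norm Ii)
      also have "(\<lambda>w. \<Sum>v\<in>R i. norm (?I i v w)) = (\<lambda>w. norm (g w))"
      proof
        fix w
        have "(\<Sum>v\<in>R i. norm (?I i v w)) = (\<Sum>v\<in>R i. if v = F i w then norm (g w) else 0)"
          by (rule sum.cong) auto
        then show "(\<Sum>v\<in>R i. norm (?I i v w)) = norm (g w)"
          using fin by (simp add: R_def)
      qed
      finally show "(\<Sum>v\<in>R i. norm (c i v)) \<le> (LINT w|lborel. norm (g w))" .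
    qed
    finally show ?thesis .
  qed
  obtain C N where C: "C \<ge> 0" "\<And>h. schwartz h \<Longrightarrow> norm (f h) \<le> C * schwartz_seminorm N h"
    using tempered_bound[OF f] by blast
  have "\<forall>is k. \<exists>D\<ge>0. \<forall>y v w. (1 + norm y) ^ k * norm (iter_pdiff is h (y + v) - iter_pdiff is h (y + w))
        \<le> D * (1 + norm v + norm w) ^ k * norm (v - w)"
    using schwartz_mean_value[OF h] by metis
  then obtain D where D: "\<And>is k. D is k \<ge> 0"
    "\<And>is k y v w. (1 + norm y) ^ k * norm (iter_pdiff is h (y + v) - iter_pdiff is h (y + w))
        \<le> D is k * (1 + norm v + norm w) ^ k * norm (v - w)"
    by metis
  \<comment> \<open>A majorant of the weighted difference of integrands that is free of y. The
    factor 3 comes from 1 + |w| + |F i w| \<le> 3 (1 + |w|). Since |w - F i w| \<le> 3 |w|, one more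
    power of the weight dominates it uniformly in i.\<close>
  define e where "e is k i w = D is k * 3 ^ k * ((1 + norm w) ^ k * norm (g w)) * norm (w - F i w)"
    for "is" k i w
  have e_meas [measurable]: "e is k i \<in> borel_measurable borel" for "is" k i
    unfolding e_def by measurable
  have e_dom: "norm (e is k i w) \<le> D is k * 3 ^ Suc k * ((1 + norm w) ^ Suc k * norm (g w))" for "is" k i w
  proof -
    have "norm (w - F i w) \<le> 3 * norm w"
      using norm_triangle_ineq4[of w "F i w"] F(3)[of i w] by simp
    also have "\<dots> \<le> 3 * (1 + norm w)" by simp
    finally have "e is k i w \<le> D is k * 3 ^ k * ((1 + norm w) ^ k * norm (g w)) * (3 * (1 + norm w))"
      unfolding e_def by (rule mult_left_mono) (simp add: D(1))
    moreover have "e is k i w \<ge> 0" unfolding e_def using D(1) by simp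
    ultimately show ?thesis by (simp add: algebra_simps)
  qed
  have dom_int: "integrable lborel (\<lambda>w. D is k * 3 ^ Suc k * ((1 + norm w) ^ Suc k * norm (g w)))" for "is" k
    by (intro integrable_mult_right schwartz_integrable_weight g)
  have e_int: "integrable lborel (e is k i)" for "is" k i
    by (rule Bochner_Integration.integrable_bound[OF dom_int[of "is" k]])
      (use order_trans[OF e_dom abs_ge_self] in \<open>auto simp del: power_Suc\<close>)
  have e_lim: "(\<lambda>i. LINT w|lborel. e is k i w) \<longlonglongrightarrow> 0" for "is" k
  proof -
    have "(\<lambda>i. LINT w|lborel. e is k i w) \<longlonglongrightarrow> (LINT w|(lborel :: (real^'n) measure). 0)"
    proof (rule integral_dominated_convergence[OF _ _ dom_int[of "is" k]])
      have "(\<lambda>i. e is k i w) \<longlonglongrightarrow> 0" for w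
      proof -
        have "(\<lambda>i. w - F i w) \<longlonglongrightarrow> w - w"
          by (intro tendsto_intros F)
        then have "(\<lambda>i. norm (w - F i w)) \<longlonglongrightarrow> 0"
          by (simp add: tendsto_norm_zero)
        then show ?thesis unfolding e_def by (rule tendsto_mult_right_zero)
      qed
      then show "AE w in lborel. (\<lambda>i. e is k i w) \<longlonglongrightarrow> 0" by simp
      show "AE w in lborel. norm (e is k i w) \<le> D is k * 3 ^ Suc k * ((1 + norm w) ^ Suc k * norm (g w))" for i
        using e_dom by simp
    qed auto
    then show ?thesis by simp
  qed
  have diff: "schwartz (\<lambda>x. corr g h x - \<psi> i x)" for i
    by (intro schwartz_diff schwartz_corr g h \<psi>)
  have pt: "(1 + norm y) ^ k * norm (iter_pdiff is (\<lambda>x. corr g h x - \<psi> i x) y) \<le> (LINT w|lborel. e is k i w)"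
    for "is" k y i
  proof -
    let ?h = "iter_pdiff is h"
    have i1: "integrable lborel (\<lambda>w. g w * ?h (y + w))" and i2: "integrable lborel (\<lambda>w. g w * ?h (y + F i w))"
      by (intro integrable_mult_schwartz gi h; measurable)+
    have "iter_pdiff is (\<lambda>x. corr g h x - \<psi> i x) y = iter_pdiff is (corr g h) y - iter_pdiff is (\<psi> i) y"
      using iter_pdiff_lincomb[OF \<psi>[of i] schwartz_corr[OF g h], of "is" "-1"] by simp
    also have "\<dots> = (LINT w|lborel. g w * ?h (y + w)) - (LINT w|lborel. g w * ?h (y + F i w))"
      by (simp add: iter_pdiff_corr[OF gi h] corr_def D\<psi>)
    also have "\<dots> = (LINT w|lborel. g w * ?h (y + w) - g w * ?h (y + F i w))"
      using i1 i2 by simp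
    finally have "(1 + norm y) ^ k * norm (iter_pdiff is (\<lambda>x. corr g h x - \<psi> i x) y)
        = norm (LINT w|lborel. (1 + norm y) ^ k *\<^sub>R (g w * ?h (y + w) - g w * ?h (y + F i w)))"
      by simp
    also have "\<dots> \<le> (LINT w|lborel. e is k i w)"
    proof (rule Bochner_Integration.integral_norm_bound_integral)
      show "integrable lborel (\<lambda>w. (1 + norm y) ^ k *\<^sub>R (g w * ?h (y + w) - g w * ?h (y + F i w)))"
        by (intro integrable_scaleR_right Bochner_Integration.integrable_diff i1 i2)
      show "norm ((1 + norm y) ^ k *\<^sub>R (g w * ?h (y + w) - g w * ?h (y + F i w))) \<le> e is k i w" for w
      proof -
        have "norm ((1 + norm y) ^ k *\<^sub>R (g w * ?h (y + w) - g w * ?h (y + F i w)))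
            = norm (g w) * ((1 + norm y) ^ k * norm (?h (y + w) - ?h (y + F i w)))"
          by (simp add: right_diff_distrib[symmetric] norm_mult)
        also have "\<dots> \<le> norm (g w) * (D is k * (1 + norm w + norm (F i w)) ^ k * norm (w - F i w))"
          by (intro mult_left_mono D) auto
        also have "\<dots> \<le> norm (g w) * (D is k * (3 * (1 + norm w)) ^ k * norm (w - F i w))"
          using F(3)[of i w] by (intro mult_left_mono mult_right_mono power_mono) (auto simp: D(1))
        also have "\<dots> = e is k i w" unfolding e_def power_mult_distrib by (simp add: mult_ac)
        finally show ?thesis .
      qed
    qed (rule e_int)
    finally show ?thesis .
  qed
  \<comment> \<open>Only the finitely many indices in the seminorm that bounds f matter, so the
    termwise limits suffice.\<close>
  define E where "E i = C * (\<Sum>is\<in>{is::'n list. length is \<le> N}. \<Sum>k\<le>N. LINT w|lborel. e is k i w)" for i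
  have "E \<longlonglongrightarrow> C * (\<Sum>is\<in>{is::'n list. length is \<le> N}. \<Sum>k\<le>N. 0)"
    unfolding E_def by (intro tendsto_intros e_lim)
  then have E: "E \<longlonglongrightarrow> 0" by simp
  have "norm (f (corr g h)) \<le> E i + (LINT w|lborel. norm (g w)) * S" for i
  proof -
    have "norm (f (corr g h) - f (\<psi> i)) \<le> C * schwartz_seminorm N (\<lambda>x. corr g h x - \<psi> i x)"
      using C(2)[OF diff[of i]] by (simp add: tempered_diff[OF f schwartz_corr[OF g h] \<psi>])
    also have "\<dots> \<le> E i"
      unfolding E_def schwartz_seminorm_def
      by (intro mult_left_mono sum_mono cSUP_least pt C(1)) auto
    finally show ?thesis
      using f\<psi>[of i] norm_triangle_sub[of "f (corr g h)" "f (\<psi> i)"] by linarith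
  qed
  moreover have "(\<lambda>i. E i + (LINT w|lborel. norm (g w)) * S) \<longlonglongrightarrow> 0 + (LINT w|lborel. norm (g w)) * S"
    by (intro tendsto_intros E)
  ultimately have "norm (f (corr g h)) \<le> 0 + (LINT w|lborel. norm (g w)) * S"
    by (intro LIMSEQ_le_const) auto
  then show ?thesis by simp
qed

section \<open>Injectivity of the Fourier transform\<close>

lemma integral_lborel_affine:
  fixes f :: "'a::euclidean_space \<Rightarrow> 'b::{banach, second_countable_topology}"
  assumes [measurable]: "f \<in> borel_measurable borel" and c: "c \<noteq> 0"
  shows "(LINT x|lborel. f x) = \<bar>c\<bar> ^ DIM('a) *\<^sub>R (LINT x|lborel. f (t + c *\<^sub>R x))"
proof -
  have "(LINT x|lborel. f x)
      = (LINT x|density (distr lborel borel (\<lambda>x. t + c *\<^sub>R x)) (\<lambda>_. ennreal (\<bar>c\<bar> ^ DIM('a))). f x)"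
    using lborel_affine[OF c, of t] by (simp add: ennreal_power)
  also have "\<dots> = \<bar>c\<bar> ^ DIM('a) *\<^sub>R (LINT x|lborel. f (t + c *\<^sub>R x))"
    by (subst integral_density) (auto simp: integral_distr)
  finally show ?thesis .
qed

lemma integrable_lborel_affine:
  fixes f :: "'a::euclidean_space \<Rightarrow> 'b::{banach, second_countable_topology}"
  assumes f: "integrable lborel f" and c: "c \<noteq> 0"
  shows "integrable lborel (\<lambda>x. f (t + c *\<^sub>R x))"
proof -
  have [measurable]: "f \<in> borel_measurable borel" using f by auto
  have "integrable (density (distr lborel borel (\<lambda>x. t + c *\<^sub>R x)) (\<lambda>_. ennreal (\<bar>c\<bar> ^ DIM('a)))) f"
    using lborel_affine[OF c, of t] f by (simp add: ennreal_power)
  then have "integrable (distr lborel borel (\<lambda>x. t + c *\<^sub>R x)) (\<lambda>x. \<bar>c\<bar> ^ DIM('a) *\<^sub>R f x)"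
    by (subst (asm) integrable_density) auto
  then have "integrable (distr lborel borel (\<lambda>x. t + c *\<^sub>R x))
      (\<lambda>x. inverse (\<bar>c\<bar> ^ DIM('a)) *\<^sub>R (\<bar>c\<bar> ^ DIM('a) *\<^sub>R f x))"
    by (rule integrable_scaleR_right)
  then have "integrable (distr lborel borel (\<lambda>x. t + c *\<^sub>R x)) f"
    using c by simp
  then show ?thesis
    by (subst (asm) integrable_distr_eq) auto
qed

section \<open>Fourier transforms of integrable functions\<close>

lemma cis_measurable [measurable]: "cis \<in> borel_measurable borel"
  by (intro borel_measurable_continuous_onI continuous_intros)

lemma norm_fourier_le:
  assumes "integrable lborel g"
  shows "norm (fourier g \<xi>) \<le> (LINT x|lborel. norm (g x))"
  unfolding fourier_def using integral_norm_bound[of lborel "\<lambda>x. g x * cis (- (x \<bullet> \<xi>))"]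
  by (simp add: norm_mult)

lemma integrable_mult_cis:
  fixes g :: "real^'n::finite \<Rightarrow> complex"
  assumes "integrable lborel g" "s \<in> borel_measurable borel"
  shows "integrable lborel (\<lambda>x. g x * cis (s x))"
proof -
  have [measurable]: "g \<in> borel_measurable borel" "s \<in> borel_measurable borel" using assms by auto
  show ?thesis
    by (rule Bochner_Integration.integrable_bound[OF assms(1)]) (auto simp: norm_mult)
qed

lemma fourier_measurable:
  fixes g :: "real^'n::finite \<Rightarrow> complex"
  assumes "integrable lborel g"
  shows "fourier g \<in> borel_measurable borel"
proof -
  have [measurable]: "g \<in> borel_measurable borel" using assms by auto
  have "(\<lambda>\<xi>. LINT x|lborel. g x * cis (- (x \<bullet> \<xi>))) \<in> borel_measurable borel"
    by (rule lborel.borel_measurable_lebesgue_integral) measurable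
  then show ?thesis by (simp add: fourier_def[abs_def])
qed

text \<open>The common Fubini hypothesis: c = 1 serves the convolution theorem and c = 0 the product
  of two separate variables. The phase s has modulus one and leaves absolute integrability
  untouched.\<close>

lemma integrable_product_shear:
  fixes g k :: "real^'n::finite \<Rightarrow> complex" and s :: "real^'n \<Rightarrow> real^'n \<Rightarrow> real"
  assumes g: "integrable lborel g" and k: "integrable lborel k"
    and s [measurable]: "(\<lambda>(x, y). s x y) \<in> borel_measurable (borel \<Otimes>\<^sub>M borel)"
  shows "integrable (lborel \<Otimes>\<^sub>M lborel) (\<lambda>(x, y). g x * k (y - c *\<^sub>R x) * cis (s x y))"
proof -
  have [measurable]: "g \<in> borel_measurable borel" "k \<in> borel_measurable borel" using g k by auto
  have k': "integrable lborel (\<lambda>y. k (y - c *\<^sub>R x))" for x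
    using integrable_lborel_affine[OF k, of 1 "- c *\<^sub>R x"] by simp
  have nk: "(LINT y|lborel. norm (k (y - c *\<^sub>R x))) = (LINT y|lborel. norm (k y))" for x
    using integral_lborel_affine[of "\<lambda>y. norm (k y)" 1 "- c *\<^sub>R x"] by simp
  show ?thesis
  proof (rule lborel_pair.Fubini_integrable)
    show "(\<lambda>(x, y). g x * k (y - c *\<^sub>R x) * cis (s x y)) \<in> borel_measurable (lborel \<Otimes>\<^sub>M lborel)"
      by measurable
    show "integrable lborel (\<lambda>x. LINT y|lborel. norm (case (x, y) of (x, y) \<Rightarrow> g x * k (y - c *\<^sub>R x) * cis (s x y)))"
      using g by (simp add: norm_mult nk)
    have "integrable lborel (\<lambda>y. g x * (k (y - c *\<^sub>R x) * cis (s x y)))" for x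
      by (intro integrable_mult_right integrable_mult_cis k') measurable
    then show "AE x in lborel. integrable lborel (\<lambda>y. case (x, y) of (x, y) \<Rightarrow> g x * k (y - c *\<^sub>R x) * cis (s x y))"
      by (simp add: mult.assoc)
  qed
qed

definition conv :: "(real^'n::finite \<Rightarrow> complex) \<Rightarrow> (real^'n \<Rightarrow> complex) \<Rightarrow> real^'n \<Rightarrow> complex" where
  "conv g k z = (LINT w|lborel. g w * k (z - w))"

lemma fourier_conv:
  fixes g k :: "real^'n::finite \<Rightarrow> complex"
  assumes g: "integrable lborel g" and k: "integrable lborel k"
  shows "fourier (conv g k) \<xi> = fourier g \<xi> * fourier k \<xi>"
proof -
  have [measurable]: "g \<in> borel_measurable borel" "k \<in> borel_measurable borel" using g k by auto
  have "fourier (conv g k) \<xi> = (LINT z|lborel. LINT w|lborel. g w * k (z - w) * cis (- (z \<bullet> \<xi>)))"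
    by (simp add: fourier_def conv_def)
  also have "\<dots> = (LINT w|lborel. LINT z|lborel. g w * k (z - w) * cis (- (z \<bullet> \<xi>)))"
    by (rule lborel_pair.Fubini_integral)
      (use integrable_product_shear[OF g k, of "\<lambda>w z. - (z \<bullet> \<xi>)" 1] in simp)
  also have "\<dots> = (LINT w|lborel. (g w * cis (- (w \<bullet> \<xi>))) * fourier k \<xi>)"
  proof (intro Bochner_Integration.integral_cong refl)
    fix w
    have cis: "cis (- ((z + w) \<bullet> \<xi>)) = cis (- (w \<bullet> \<xi>)) * cis (- (z \<bullet> \<xi>))" for z
      by (simp add: inner_add_left cis_mult add.commute)
    have "(LINT z|lborel. g w * k (z - w) * cis (- (z \<bullet> \<xi>)))
        = (LINT z|lborel. g w * k z * cis (- ((z + w) \<bullet> \<xi>)))"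
      using integral_lborel_affine[of "\<lambda>z. g w * k (z - w) * cis (- (z \<bullet> \<xi>))" 1 w]
      by (simp add: add.commute)
    also have "\<dots> = (LINT z|lborel. (g w * cis (- (w \<bullet> \<xi>))) * (k z * cis (- (z \<bullet> \<xi>))))"
      by (intro Bochner_Integration.integral_cong refl) (simp add: cis mult_ac)
    finally show "(LINT z|lborel. g w * k (z - w) * cis (- (z \<bullet> \<xi>))) = (g w * cis (- (w \<bullet> \<xi>))) * fourier k \<xi>"
      by (simp add: fourier_def)
  qed
  finally show ?thesis by (simp add: fourier_def)
qed

text \<open>Expanding \<open>fourier g\<close> under the integral writes the transform of the
  product as a superposition of values of \<open>fourier F\<close>, all zero. Integrability is part
  of the conclusion so that the lemma can be applied to its own output, which produces the squared
  modulus of a cutoff.\<close>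

lemma fourier_mult_fourier_eq_0:
  fixes F g :: "real^'n::finite \<Rightarrow> complex" and r :: real and y :: "real^'n"
  assumes F: "integrable lborel F" "\<And>\<xi>. fourier F \<xi> = 0" and g: "integrable lborel g"
  defines "G \<equiv> \<lambda>x. F x * fourier g (r *\<^sub>R (y - x))"
  shows "integrable lborel G" "fourier G \<zeta> = 0"
proof -
  have [measurable]: "F \<in> borel_measurable borel" "g \<in> borel_measurable borel"
    "fourier g \<in> borel_measurable borel"
    using F g fourier_measurable by auto
  show "integrable lborel G"
  proof (rule Bochner_Integration.integrable_bound)
    show "integrable lborel (\<lambda>x. (LINT x|lborel. norm (g x)) * norm (F x))"
      using F(1) by auto
    show "G \<in> borel_measurable lborel" unfolding G_def by measurable
    have "norm (G x) \<le> norm ((LINT x|lborel. norm (g x)) * norm (F x))" for x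
      unfolding G_def norm_mult
      using mult_right_mono[OF norm_fourier_le[OF g] norm_ge_zero] order_trans[OF _ abs_ge_self]
      by (fastforce simp: mult.commute)
    then show "AE x in lborel. norm (G x) \<le> norm ((LINT x|lborel. norm (g x)) * norm (F x))" by simp
  qed
  let ?H = "\<lambda>x \<xi>. F x * g \<xi> * cis (- (\<xi> \<bullet> (r *\<^sub>R (y - x))) - x \<bullet> \<zeta>)"
  have "fourier G \<zeta> = (LINT x|lborel. LINT \<xi>|lborel. ?H x \<xi>)"
    unfolding fourier_def G_def
    by (simp add: mult.assoc integral_mult_right_zero[symmetric] integral_mult_left_zero[symmetric] cis_mult
        del: integral_mult_right_zero integral_mult_left_zero)
  also have "\<dots> = (LINT \<xi>|lborel. LINT x|lborel. ?H x \<xi>)"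
    by (rule lborel_pair.Fubini_integral[symmetric])
      (use integrable_product_shear[OF F(1) g, of "\<lambda>x \<xi>. - (\<xi> \<bullet> (r *\<^sub>R (y - x))) - x \<bullet> \<zeta>" 0] in simp)
  also have "\<dots> = (LINT \<xi>|(lborel :: (real^'n) measure). 0)"
  proof (intro Bochner_Integration.integral_cong refl)
    fix \<xi>
    have "(LINT x|lborel. ?H x \<xi>)
        = (LINT x|lborel. (g \<xi> * cis (- (r * (\<xi> \<bullet> y)))) * (F x * cis (- (x \<bullet> (\<zeta> - r *\<^sub>R \<xi>)))))"
      by (intro Bochner_Integration.integral_cong refl)
        (simp add: mult_ac cis_mult inner_diff_right inner_commute algebra_simps)
    also have "\<dots> = (g \<xi> * cis (- (r * (\<xi> \<bullet> y)))) * fourier F (\<zeta> - r *\<^sub>R \<xi>)"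
      by (simp add: fourier_def)
    finally show "(LINT x|lborel. ?H x \<xi>) = 0" by (simp add: F(2))
  qed
  finally show "fourier G \<zeta> = 0" by simp
qed

lemma cnj_fourier: "cnj (fourier g \<xi>) = fourier (\<lambda>x. cnj (g x)) (- \<xi>)"
  by (simp add: fourier_def Bochner_Integration.integral_cnj[symmetric] cis_cnj
      del: Bochner_Integration.integral_cnj)

text \<open>With \<open>K = fourier \<phi>\<close>, the function \<open>x \<mapsto> F x * \<bar>K (r (y - x))\<bar>\<^sup>2\<close> still has vanishing transform,
  hence integral 0; but \<open>\<bar>K\<bar>\<^sup>2\<close> is 1 near 0 and vanishes outside the ball of radius 2, so for large r the
  integral has a contribution from near y only.\<close>
lemma fourier_eq_0_imp_eq_0:
  fixes F \<phi> :: "real^'n::finite \<Rightarrow> complex"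
  assumes \<phi>: "LP_generator \<phi>"
    and F: "integrable lborel F" "continuous_on UNIV F" "\<And>\<xi>. fourier F \<xi> = 0"
  shows "F y = 0"
proof (rule ccontr)
  assume nz: "F y \<noteq> 0"
  have gi: "integrable lborel \<phi>"
    using \<phi> schwartz_integrable by (auto simp: LP_generator_def)
  have K: "norm \<xi> \<le> 1 \<Longrightarrow> fourier \<phi> \<xi> = 1" "norm \<xi> \<ge> 2 \<Longrightarrow> fourier \<phi> \<xi> = 0" for \<xi>
    using \<phi> by (auto simp: LP_generator_def)
  obtain \<delta> where \<delta>: "\<delta> > 0" "\<And>x. dist x y < \<delta> \<Longrightarrow> dist (F x) (F y) < norm (F y) / 2"
    using F(2) nz unfolding continuous_on_iff by (metis UNIV_I half_gt_zero zero_less_norm_iff)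
  \<comment> \<open>The rescaled cutoff vanishes once |y - x| \<ge> 2 / r = \<delta>, so its support
    stays where F is close to F y.\<close>
  define r where "r = 2 / \<delta>"
  have r: "r > 0" using \<delta> by (simp add: r_def)
  define G where "G x = F x * fourier \<phi> (r *\<^sub>R (y - x)) * cnj (fourier \<phi> (r *\<^sub>R (y - x)))" for x
  note G1 = fourier_mult_fourier_eq_0[OF F(1,3) gi, of r y]
  have "integrable lborel (\<lambda>x. cnj (\<phi> x))" using gi by simp
  note fourier_mult_fourier_eq_0[OF G1 this, of "- r" y]
  then have G: "integrable lborel G" "fourier G 0 = 0"
    unfolding G_def[abs_def] cnj_fourier by (auto simp: scaleR_minus_left)
  have G_eq: "G x = of_real ((norm (fourier \<phi> (r *\<^sub>R (y - x))))\<^sup>2) * F x" for x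
    using complex_norm_square[of "fourier \<phi> (r *\<^sub>R (y - x))"]
    by (simp add: G_def mult_ac)
  let ?c = "(norm (F y))\<^sup>2 / 2"
  \<comment> \<open>Multiplying by the conjugate of F y turns closeness to F y into a positive real
    part.\<close>
  have pos: "Re (F x * cnj (F y)) \<ge> ?c" if "dist x y < \<delta>" for x
  proof -
    have "F x * cnj (F y) = (F x - F y) * cnj (F y) + of_real ((norm (F y))\<^sup>2)"
      using complex_norm_square[of "F y"] by (simp add: algebra_simps)
    then have "Re (F x * cnj (F y)) = Re ((F x - F y) * cnj (F y)) + (norm (F y))\<^sup>2"
      by (metis Re_complex_of_real plus_complex.sel(1))
    moreover have "\<bar>Re ((F x - F y) * cnj (F y))\<bar> \<le> norm (F x - F y) * norm (F y)"
      using abs_Re_le_cmod[of "(F x - F y) * cnj (F y)"] by (simp add: norm_mult)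
    moreover have "norm (F x - F y) * norm (F y) \<le> (norm (F y) / 2) * norm (F y)"
      using \<delta>(2)[OF that] by (intro mult_right_mono) (auto simp: dist_norm)
    ultimately show ?thesis by (simp add: power2_eq_square)
  qed
  have lower: "?c * indicator (ball y (1 / r)) x \<le> Re (G x * cnj (F y))" for x
  proof -
    let ?k = "norm (fourier \<phi> (r *\<^sub>R (y - x)))"
    have nr: "norm (r *\<^sub>R (y - x)) = r * dist y x"
      using r by (simp add: dist_norm)
    have eq: "Re (G x * cnj (F y)) = ?k\<^sup>2 * Re (F x * cnj (F y))"
      unfolding G_eq by (simp add: mult.assoc)
    \<comment> \<open>Plateau of the cutoff, where the integrand is bounded below; transition shell,
      where it is nonnegative; exterior, where it vanishes.\<close>
    consider "dist y x < 1 / r" | "dist y x \<ge> 1 / r" "dist x y < \<delta>" | "dist x y \<ge> \<delta>" "dist y x \<ge> 1 / r"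
      by linarith
    then show ?thesis
    proof cases
      case 1
      then have "?k = 1"
        using r K(1)[of "r *\<^sub>R (y - x)"] unfolding nr by (simp add: field_simps)
      moreover have "1 / r \<le> \<delta>" using \<delta> by (simp add: r_def)
      ultimately show ?thesis using eq pos[of x] 1 by (simp add: dist_commute)
    next
      case 2
      have "?c \<ge> 0" by simp
      with pos[OF 2(2)] have "Re (F x * cnj (F y)) \<ge> 0" by linarith
      then have "Re (G x * cnj (F y)) \<ge> 0" unfolding eq by simp
      then show ?thesis using 2 by simp
    next
      case 3
      then have "2 \<le> norm (r *\<^sub>R (y - x))"
        using \<delta>(1) unfolding nr by (simp add: r_def dist_commute field_simps)
      then have "?k = 0" using K(2) by simp
      then show ?thesis using eq 3 by simp
    qed
  qed
  have "0 < ?c * measure lborel (ball y (1 / r))"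
    using nz r by (simp add: content_ball)
  also have "\<dots> = (LINT x|lborel. ?c * indicator (ball y (1 / r)) x)"
    by simp
  also have "\<dots> \<le> (LINT x|lborel. Re (G x * cnj (F y)))"
  proof (rule Bochner_Integration.integral_mono[OF _ _ lower])
    have "integrable lborel (indicator (ball y (1 / r)) :: real^'n \<Rightarrow> real)"
      by (rule integrable_real_indicator) (use emeasure_bounded_finite[OF bounded_ball, of y "1 / r"] in auto)
    then show "integrable lborel (\<lambda>x. ?c * indicator (ball y (1 / r)) x)"
      by (rule integrable_mult_right)
    show "integrable lborel (\<lambda>x. Re (G x * cnj (F y)))"
      by (intro integrable_Re integrable_mult_left G(1))
  qed
  also have "\<dots> = Re (fourier G 0 * cnj (F y))"
    using integral_bounded_linear[OF bounded_linear_Re integrable_mult_left[OF G(1), of "cnj (F y)"]] G(1)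
    by (simp add: fourier_def)
  also have "\<dots> = 0" using G(2) by simp
  finally show False by simp
qed

section \<open>Littlewood--Paley kernels\<close>

definition dilate :: "(real^'n::finite \<Rightarrow> complex) \<Rightarrow> nat \<Rightarrow> real^'n \<Rightarrow> complex" where
  "dilate \<phi> j y = of_real (2 ^ (j * CARD('n))) * \<phi> ((2 ^ j) *\<^sub>R y)"

lemma LP_kernel_eq_dilate:
  "LP_kernel \<phi> 0 = \<phi>"
  "j > 0 \<Longrightarrow> LP_kernel \<phi> j = (\<lambda>y. dilate \<phi> j y - dilate \<phi> (j - 1) y)"
  by (auto simp: LP_kernel_def dilate_def)

lemma schwartz_dilate:
  assumes "schwartz \<phi>"
  shows "schwartz (dilate \<phi> j)"
  using schwartz_cmult[OF schwartz_affine[OF assms, of "2 ^ j" 0]]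
  by (simp add: dilate_def[abs_def])

lemma schwartz_LP_kernel:
  assumes "schwartz \<phi>"
  shows "schwartz (LP_kernel \<phi> j)"
  using assms schwartz_diff[OF schwartz_dilate[OF assms] schwartz_dilate[OF assms]]
  by (cases "j = 0") (auto simp: LP_kernel_eq_dilate)

text \<open>Scale invariance of the L^1 norm keeps the constants of the frequency split independent
  of N.\<close>

lemma norm_dilate_integral:
  fixes \<phi> :: "real^'n::finite \<Rightarrow> complex"
  assumes "schwartz \<phi>"
  shows "(LINT w|lborel. norm (dilate \<phi> j w)) = (LINT w|lborel. norm (\<phi> w))"
proof -
  have "(\<lambda>w. norm (\<phi> w)) \<in> borel_measurable borel"
    using schwartz_borel_measurable[OF assms] by measurable
  from integral_lborel_affine[OF this, of "2 ^ j" 0] show ?thesis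
    by (simp add: dilate_def norm_mult norm_power power_mult)
qed

lemma fourier_dilate:
  fixes \<phi> :: "real^'n::finite \<Rightarrow> complex"
  assumes "schwartz \<phi>"
  shows "fourier (dilate \<phi> j) \<xi> = fourier \<phi> ((1 / 2 ^ j) *\<^sub>R \<xi>)"
proof -
  have [measurable]: "\<phi> \<in> borel_measurable borel"
    using assms by (rule schwartz_borel_measurable)
  have "(\<lambda>x. \<phi> x * cis (- (x \<bullet> ((1 / 2 ^ j) *\<^sub>R \<xi>)))) \<in> borel_measurable borel"
    by measurable
  from integral_lborel_affine[OF this, of "2 ^ j" 0] show ?thesis
    by (simp add: fourier_def dilate_def scaleR_conv_of_real[where 'a = complex] mult.assoc power_mult)
qed

lemma fourier_diff:
  assumes "integrable lborel g" "integrable lborel k"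
  shows "fourier (\<lambda>x. g x - k x) \<xi> = fourier g \<xi> - fourier k \<xi>"
  using assms by (simp add: fourier_def left_diff_distrib integrable_mult_cis)

lemma fourier_LP_kernel:
  assumes "schwartz \<phi>"
  shows "fourier (LP_kernel \<phi> j) \<xi> = (if j = 0 then fourier \<phi> \<xi>
    else fourier \<phi> ((1 / 2 ^ j) *\<^sub>R \<xi>) - fourier \<phi> ((1 / 2 ^ (j - 1)) *\<^sub>R \<xi>))"
  using assms
  by (auto simp: LP_kernel_eq_dilate fourier_diff fourier_dilate schwartz_integrable schwartz_dilate)

text \<open>Links the duality definition of \<open>low_pass\<close> to the kernels: a
  Littlewood--Paley piece of the low part is f tested on a convolution of two kernels, which the
  Fourier transform can identify.\<close>

lemma corr_reflect: "corr g (\<lambda>y. k (x - y)) y = conv g k (x - y)"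
  by (simp add: conv_def corr_def algebra_simps)

lemma schwartz_conv:
  assumes "schwartz g" "schwartz k"
  shows "schwartz (conv g k)"
proof -
  have "schwartz (\<lambda>z. corr g (\<lambda>y. k (0 - y)) (0 - z))"
    by (intro schwartz_reflect schwartz_corr assms)
  then show ?thesis unfolding corr_reflect by simp
qed

text \<open>The generator appears because its transform is the cutoff in the uniqueness
  argument.\<close>

lemma schwartz_fourier_unique:
  fixes \<phi> g k :: "real^'n::finite \<Rightarrow> complex"
  assumes "LP_generator \<phi>" "schwartz g" "schwartz k" "\<And>\<xi>. fourier g \<xi> = fourier k \<xi>"
  shows "g = k"
proof
  fix y
  have s: "schwartz (\<lambda>x. g x - k x)" using assms by (intro schwartz_diff)
  have "g y - k y = 0"
  proof (rule fourier_eq_0_imp_eq_0[OF assms(1), of "\<lambda>x. g x - k x"])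
    show "continuous_on UNIV (\<lambda>x. g x - k x)"
      using schwartz_continuous[OF s, of "[]"] by simp
  qed (use assms s in \<open>auto simp: schwartz_integrable fourier_diff\<close>)
  then show "g y = k y" by simp
qed

text \<open>On the Fourier side \<open>dilate \<phi> N\<close> is 1 up to radius 2^N and 0 from
  2^(N+1) on, while the kernel of index j > 0 lives between 2^(j-1) and 2^(j+1), and that of index 0
  within radius 2. For j < N the kernel sits inside the plateau; for j \<ge> N + 2 the two supports
  do not overlap.\<close>

lemma conv_dilate_LP_kernel:
  fixes \<phi> :: "real^'n::finite \<Rightarrow> complex"
  assumes \<phi>: "LP_generator \<phi>"
  shows "j < N \<Longrightarrow> conv (dilate \<phi> N) (LP_kernel \<phi> j) = LP_kernel \<phi> j"
    and "N + 2 \<le> j \<Longrightarrow> conv (dilate \<phi> N) (LP_kernel \<phi> j) = (\<lambda>x. 0)"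
proof -
  have s: "schwartz \<phi>"
    and K: "\<And>\<xi>. norm \<xi> \<le> 1 \<Longrightarrow> fourier \<phi> \<xi> = 1" "\<And>\<xi>. norm \<xi> \<ge> 2 \<Longrightarrow> fourier \<phi> \<xi> = 0"
    using \<phi> by (auto simp: LP_generator_def)
  note sc = schwartz_conv[OF schwartz_dilate[OF s] schwartz_LP_kernel[OF s]]
  have F: "fourier (conv (dilate \<phi> N) (LP_kernel \<phi> j)) \<xi>
      = fourier \<phi> ((1 / 2 ^ N) *\<^sub>R \<xi>) * fourier (LP_kernel \<phi> j) \<xi>" for \<xi>
    using s by (simp add: fourier_conv fourier_dilate schwartz_integrable schwartz_dilate schwartz_LP_kernel)
  show "conv (dilate \<phi> N) (LP_kernel \<phi> j) = LP_kernel \<phi> j" if "j < N"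
  proof (rule schwartz_fourier_unique[OF \<phi> sc schwartz_LP_kernel[OF s]])
    fix \<xi>
    show "fourier (conv (dilate \<phi> N) (LP_kernel \<phi> j)) \<xi> = fourier (LP_kernel \<phi> j) \<xi>"
    proof (cases "norm \<xi> \<le> 2 ^ N")
      case True
      then show ?thesis by (simp add: F K)
    next
      case False
      have "(2::real) * 2 ^ j \<le> 2 ^ N"
        using power_increasing[of "Suc j" N "2::real"] that by simp
      moreover have "(2::real) * 2 ^ (j - 1) \<le> 2 ^ N" if "j > 0"
        using power_increasing[of j N "2::real"] \<open>j < N\<close> that by (cases j) auto
      moreover have "(1::real) \<le> 2 ^ j" by simp
      ultimately have "norm \<xi> \<ge> 2 * 2 ^ j" "norm \<xi> \<ge> 2" "j > 0 \<Longrightarrow> norm \<xi> \<ge> 2 * 2 ^ (j - 1)"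
        using False by linarith+
      then have "fourier (LP_kernel \<phi> j) \<xi> = 0"
        by (cases "j = 0") (auto simp: fourier_LP_kernel[OF s] K field_simps)
      then show ?thesis by (simp add: F)
    qed
  qed
  show "conv (dilate \<phi> N) (LP_kernel \<phi> j) = (\<lambda>x. 0)" if "N + 2 \<le> j"
  proof (rule schwartz_fourier_unique[OF \<phi> sc schwartz_zero])
    fix \<xi> :: "real^'n"
    have z: "fourier (\<lambda>x. 0) \<xi> = 0" by (simp add: fourier_def)
    show "fourier (conv (dilate \<phi> N) (LP_kernel \<phi> j)) \<xi> = fourier (\<lambda>x. 0) \<xi>"
    proof (cases "norm \<xi> \<le> 2 ^ (j - 1)")
      case True
      then have "norm \<xi> \<le> 2 ^ j"
        by (rule order_trans) (intro power_increasing, auto)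
      with True have "fourier (LP_kernel \<phi> j) \<xi> = 0"
        using that by (simp add: fourier_LP_kernel[OF s] K)
      then show ?thesis by (simp add: F z)
    next
      case False
      have "(2::real) * 2 ^ N \<le> 2 ^ (j - 1)"
        using power_increasing[of "Suc N" "j - 1" "2::real"] that by simp
      with False have "fourier \<phi> ((1 / 2 ^ N) *\<^sub>R \<xi>) = 0"
        by (intro K) (simp add: field_simps)
      then show ?thesis by (simp add: F z)
    qed
  qed
qed

text \<open>The distribution \<open>f * dilate \<phi> N\<close>, defined by duality; by telescoping it is the sum of the
  Littlewood--Paley pieces of f of index at most N.\<close>
definition low_pass :: "(real^'n::finite \<Rightarrow> complex) \<Rightarrow> nat \<Rightarrow> ((real^'n \<Rightarrow> complex) \<Rightarrow> complex)
    \<Rightarrow> (real^'n \<Rightarrow> complex) \<Rightarrow> complex" where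
  "low_pass \<phi> N f h = f (corr (dilate \<phi> N) h)"

lemma tempered_low_pass:
  fixes f :: "(real^'n::finite \<Rightarrow> complex) \<Rightarrow> complex"
  assumes f: "tempered f" and \<phi>: "schwartz \<phi>"
  shows "tempered (low_pass \<phi> N f)"
  unfolding tempered_def low_pass_def
proof (intro conjI allI impI)
  let ?g = "dilate \<phi> N"
  note g = schwartz_dilate[OF \<phi>, of N]
  note gi = schwartz_integrable[OF g]
  fix h k :: "real^'n \<Rightarrow> complex" and a :: complex
  assume hk: "schwartz h \<and> schwartz k"
  have int: "integrable lborel (\<lambda>w. ?g w * h (y + w))" if "schwartz h" for h y
    using integrable_mult_schwartz[OF gi that, of "\<lambda>w. y + w" "[]"] by simp
  have "corr ?g (\<lambda>x. a * h x + k x) = (\<lambda>y. a * corr ?g h y + corr ?g k y)"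
    using hk int by (auto simp: corr_def distrib_left mult.left_commute)
  then show "f (corr ?g (\<lambda>x. a * h x + k x)) = a * f (corr ?g h) + f (corr ?g k)"
    using hk by (simp add: tempered_linear[OF f] schwartz_corr[OF g])
next
  let ?g = "dilate \<phi> N"
  note g = schwartz_dilate[OF \<phi>, of N]
  obtain C M where C: "C \<ge> 0" "\<And>h. schwartz h \<Longrightarrow> norm (f h) \<le> C * schwartz_seminorm M h"
    using tempered_bound[OF f] by blast
  obtain B where B: "B \<ge> 0" "\<And>h. schwartz h \<Longrightarrow> schwartz_seminorm M (corr ?g h) \<le> B * schwartz_seminorm M h"
    using schwartz_seminorm_corr[OF g] by blast
  have "norm (f (corr ?g h)) \<le> C * B * schwartz_seminorm M h" if h: "schwartz h" for h
    using order_trans[OF C(2)[OF schwartz_corr[OF g h]] mult_left_mono[OF B(2)[OF h] C(1)]]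
    by (simp add: mult.assoc)
  then show "\<exists>C M. \<forall>h. schwartz h \<longrightarrow> norm (f (corr ?g h)) \<le> C * schwartz_seminorm M h"
    by blast
qed

lemma tempered_minus:
  fixes f g :: "(real^'n::finite \<Rightarrow> complex) \<Rightarrow> complex"
  assumes f: "tempered f" and g: "tempered g"
  shows "tempered (\<lambda>h. f h - g h)"
  unfolding tempered_def
proof (intro conjI allI impI)
  fix h k :: "real^'n \<Rightarrow> complex" and a :: complex
  assume "schwartz h \<and> schwartz k"
  then show "f (\<lambda>x. a * h x + k x) - g (\<lambda>x. a * h x + k x) = a * (f h - g h) + (f k - g k)"
    by (simp add: tempered_linear[OF f] tempered_linear[OF g]) (simp add: algebra_simps)
next
  obtain C M where C: "C \<ge> 0" "\<And>h. schwartz h \<Longrightarrow> norm (f h) \<le> C * schwartz_seminorm M h"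
    using tempered_bound[OF f] by blast
  obtain D L where D: "D \<ge> 0" "\<And>h. schwartz h \<Longrightarrow> norm (g h) \<le> D * schwartz_seminorm L h"
    using tempered_bound[OF g] by blast
  have "norm (f h - g h) \<le> (C + D) * schwartz_seminorm (max M L) h" if h: "schwartz h" for h
  proof -
    have "norm (f h - g h) \<le> C * schwartz_seminorm M h + D * schwartz_seminorm L h"
      using norm_triangle_ineq4[of "f h" "g h"] C(2)[OF h] D(2)[OF h] by linarith
    also have "\<dots> \<le> C * schwartz_seminorm (max M L) h + D * schwartz_seminorm (max M L) h"
      by (intro add_mono mult_left_mono schwartz_seminorm_mono h C D) auto
    finally show ?thesis by (simp add: distrib_right)
  qed
  then show "\<exists>C M. \<forall>h. schwartz h \<longrightarrow> norm (f h - g h) \<le> C * schwartz_seminorm M h"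
    by blast
qed

text \<open>Additivity is assumed on Schwartz functions only, as in the decompositions of
  \<open>K_besov\<close>; the reflected kernels are such functions.\<close>

lemma LP_sup_triangle:
  assumes \<phi>: "schwartz \<phi>" and f: "\<And>h. schwartz h \<Longrightarrow> f h = f0 h + f1 h"
  shows "LP_sup \<phi> j f \<le> LP_sup \<phi> j f0 + LP_sup \<phi> j f1"
  unfolding LP_sup_def
proof (rule SUP_least)
  fix x
  have "LP \<phi> j f x = LP \<phi> j f0 x + LP \<phi> j f1 x"
    unfolding LP_def by (rule f[OF schwartz_reflect[OF schwartz_LP_kernel[OF \<phi>]]])
  then have "ennreal (norm (LP \<phi> j f x)) \<le> ennreal (norm (LP \<phi> j f0 x) + norm (LP \<phi> j f1 x))"
    by (intro ennreal_leI) (simp add: norm_triangle_ineq)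
  also have "\<dots> = ennreal (norm (LP \<phi> j f0 x)) + ennreal (norm (LP \<phi> j f1 x))"
    by simp
  also have "\<dots> \<le> (SUP x. ennreal (norm (LP \<phi> j f0 x))) + (SUP x. ennreal (norm (LP \<phi> j f1 x)))"
    by (intro add_mono SUP_upper) auto
  finally show "ennreal (norm (LP \<phi> j f x))
    \<le> (SUP x. ennreal (norm (LP \<phi> j f0 x))) + (SUP x. ennreal (norm (LP \<phi> j f1 x)))" .
qed

lemma LP_sup_minus: "LP_sup \<phi> j (\<lambda>h. f h - g h) \<le> LP_sup \<phi> j f + LP_sup \<phi> j g"
  unfolding LP_sup_def
proof (rule SUP_least)
  fix x
  have "ennreal (norm (LP \<phi> j (\<lambda>h. f h - g h) x)) \<le> ennreal (norm (LP \<phi> j f x) + norm (LP \<phi> j g x))"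
    unfolding LP_def by (intro ennreal_leI norm_triangle_ineq4)
  also have "\<dots> = ennreal (norm (LP \<phi> j f x)) + ennreal (norm (LP \<phi> j g x))"
    by simp
  also have "\<dots> \<le> (SUP x. ennreal (norm (LP \<phi> j f x))) + (SUP x. ennreal (norm (LP \<phi> j g x)))"
    by (intro add_mono SUP_upper) auto
  finally show "ennreal (norm (LP \<phi> j (\<lambda>h. f h - g h) x))
    \<le> (SUP x. ennreal (norm (LP \<phi> j f x))) + (SUP x. ennreal (norm (LP \<phi> j g x)))" .
qed

lemma LP_low_pass: "LP \<phi> j (low_pass \<phi> N f) x = f (\<lambda>y. conv (dilate \<phi> N) (LP_kernel \<phi> j) (x - y))"
  unfolding LP_def low_pass_def by (simp add: corr_reflect[abs_def])

lemma LP_low_pass_eq: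
  assumes "LP_generator \<phi>" "j < N"
  shows "LP \<phi> j (low_pass \<phi> N f) = LP \<phi> j f"
proof
  fix x
  show "LP \<phi> j (low_pass \<phi> N f) x = LP \<phi> j f x"
    unfolding LP_low_pass conv_dilate_LP_kernel(1)[OF assms] unfolding LP_def ..
qed

text \<open>For the second bound, the piece of the low part at x is an average, with weights
  \<open>dilate \<phi> N\<close>, of values of the same piece of f.\<close>

lemma LP_sup_low_pass:
  fixes \<phi> :: "real^'n::finite \<Rightarrow> complex"
  assumes \<phi>: "LP_generator \<phi>" and f: "tempered f"
  shows "N + 2 \<le> j \<Longrightarrow> LP_sup \<phi> j (low_pass \<phi> N f) = 0"
    and "LP_sup \<phi> j (low_pass \<phi> N f) \<le> ennreal (LINT w|lborel. norm (\<phi> w)) * LP_sup \<phi> j f"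
proof -
  let ?B = "LINT w|lborel. norm (\<phi> w)"
  have s: "schwartz \<phi>" using \<phi> by (simp add: LP_generator_def)
  show "LP_sup \<phi> j (low_pass \<phi> N f) = 0" if "N + 2 \<le> j"
    unfolding LP_sup_def LP_low_pass conv_dilate_LP_kernel(2)[OF \<phi> that] tempered_zero[OF f] by simp
  show "LP_sup \<phi> j (low_pass \<phi> N f) \<le> ennreal ?B * LP_sup \<phi> j f"
  proof (cases "LP_sup \<phi> j f = \<infinity>")
    case True
    \<comment> \<open>In \<open>ennreal\<close>, 0 times infinity is 0, so the infinite case needs a
      nonzero constant; it dominates \<open>fourier \<phi> 0\<close>, which is 1.\<close>
    have "?B \<noteq> 0"
    proof
      assume "?B = 0"
      with norm_fourier_le[OF schwartz_integrable[OF s], of 0] have "fourier \<phi> 0 = 0" by simp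
      then show False using \<phi> by (simp add: LP_generator_def)
    qed
    moreover have "?B \<ge> 0" by (rule Bochner_Integration.integral_nonneg) simp
    ultimately show ?thesis using True by (simp add: ennreal_mult_top)
  next
    case False
    then obtain S where S: "LP_sup \<phi> j f = ennreal S" "S \<ge> 0"
      by (cases "LP_sup \<phi> j f") auto
    have le: "norm (LP \<phi> j f x) \<le> S" for x
    proof -
      have "ennreal (norm (LP \<phi> j f x)) \<le> LP_sup \<phi> j f"
        unfolding LP_sup_def by (rule SUP_upper) simp
      with S show ?thesis by simp
    qed
    have "norm (LP \<phi> j (low_pass \<phi> N f) x) \<le> ?B * S" for x
    proof -
      have "norm (f (corr (dilate \<phi> N) (\<lambda>y. LP_kernel \<phi> j (x - y))))
          \<le> (LINT w|lborel. norm (dilate \<phi> N w)) * S"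
      proof (rule tempered_corr_bound[OF f schwartz_dilate[OF s] schwartz_reflect[OF schwartz_LP_kernel[OF s]]])
        \<comment> \<open>Translating the test kernel by v moves its centre from x to x - v, again a
          value of the j-th piece of f.\<close>
        show "norm (f (\<lambda>y. LP_kernel \<phi> j (x - (y + v)))) \<le> S" for v
          using le[of "x - v"] by (simp add: LP_def algebra_simps)
      qed
      then show ?thesis by (simp add: LP_def low_pass_def norm_dilate_integral[OF s])
    qed
    then have "LP_sup \<phi> j (low_pass \<phi> N f) \<le> ennreal (?B * S)"
      unfolding LP_sup_def by (intro SUP_least ennreal_leI)
    then show ?thesis using S by (simp add: ennreal_mult'')
  qed
qed

section \<open>Besov norms and the K-functional\<close>

abbreviation tail_sum :: "(real^'n::finite \<Rightarrow> complex) \<Rightarrow> ((real^'n \<Rightarrow> complex) \<Rightarrow> complex) \<Rightarrow> nat \<Rightarrow> ennreal" where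
  "tail_sum \<phi> f N \<equiv> (\<Sum>j. ennreal (2 powr (- 2 * real (j + N))) * LP_sup \<phi> (j + N) f)"

lemma ennreal_suminf_split:
  fixes g :: "nat \<Rightarrow> ennreal"
  shows "(\<Sum>j. g j) = (\<Sum>j. g (j + N)) + (\<Sum>j<N. g j)"
  by (rule suminf_offset) simp

text \<open>In any decomposition the tail of f0 is part of its norm of order -2, and for f1 each
  weight with index at least N is at most 4^(-N) = 2t. The extra factor 1/2 in t keeps t below 1
  when N = 0, and the 1/2 on the left pays for it.\<close>

lemma half_tail_sum_le_K_besov:
  fixes f :: "(real^'n::finite \<Rightarrow> complex) \<Rightarrow> complex"
  assumes \<phi>: "schwartz \<phi>"
  shows "ennreal (1 / 2) * tail_sum \<phi> f N \<le> K_besov \<phi> (2 powr (- (2 * real N + 1))) f"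
  unfolding K_besov_def
proof (rule INF_greatest, clarify)
  fix f0 f1 :: "(real^'n \<Rightarrow> complex) \<Rightarrow> complex"
  assume f: "\<forall>\<psi>. schwartz \<psi> \<longrightarrow> f \<psi> = f0 \<psi> + f1 \<psi>"
  let ?t = "2 powr (- (2 * real N + 1)) :: real"
  let ?w = "\<lambda>j. ennreal (2 powr (- 2 * real j))"
  have "tail_sum \<phi> f N \<le> (\<Sum>j. ?w (j + N) * LP_sup \<phi> (j + N) f0 + ?w (j + N) * LP_sup \<phi> (j + N) f1)"
    unfolding distrib_left[symmetric]
    by (intro suminf_le summableI mult_left_mono LP_sup_triangle[OF \<phi>]) (use f in auto)
  also have "\<dots> = tail_sum \<phi> f0 N + tail_sum \<phi> f1 N"
    by (rule suminf_add[symmetric]) auto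
  also have "tail_sum \<phi> f0 N \<le> besov_inf1 \<phi> (- 2) f0"
    unfolding besov_inf1_def by (subst ennreal_suminf_split[of _ N]) simp
  also have "tail_sum \<phi> f1 N \<le> (\<Sum>j. ennreal (2 * ?t) * LP_sup \<phi> (j + N) f1)"
  proof (intro suminf_le summableI mult_right_mono ennreal_leI)
    fix j
    have "2 powr (- 2 * real (j + N)) \<le> 2 powr (1 + - (2 * real N + 1))"
      by (intro powr_mono) auto
    then show "2 powr (- 2 * real (j + N)) \<le> 2 * ?t"
      by (subst (asm) powr_add) simp
  qed auto
  also have "\<dots> = ennreal (2 * ?t) * (\<Sum>j. LP_sup \<phi> (j + N) f1)"
    by (rule ennreal_suminf_cmult)
  also have "(\<Sum>j. LP_sup \<phi> (j + N) f1) \<le> besov_inf1 \<phi> 0 f1"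
    unfolding besov_inf1_def by (subst (2) ennreal_suminf_split[of _ N]) simp
  finally have "tail_sum \<phi> f N \<le> besov_inf1 \<phi> (- 2) f0 + ennreal (2 * ?t) * besov_inf1 \<phi> 0 f1"
    by (simp add: add_mono mult_left_mono)
  then have "ennreal (1 / 2) * tail_sum \<phi> f N
      \<le> ennreal (1 / 2) * (besov_inf1 \<phi> (- 2) f0 + ennreal (2 * ?t) * besov_inf1 \<phi> 0 f1)"
    by (rule mult_left_mono) simp
  also have "\<dots> = ennreal (1 / 2) * besov_inf1 \<phi> (- 2) f0 + ennreal ?t * besov_inf1 \<phi> 0 f1"
    by (simp add: distrib_left mult.assoc[symmetric] ennreal_mult[symmetric] del: ennreal_half)
  also have "\<dots> \<le> 1 * besov_inf1 \<phi> (- 2) f0 + ennreal ?t * besov_inf1 \<phi> 0 f1"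
  proof (intro add_mono mult_right_mono order_refl)
    show "ennreal (1 / 2) \<le> 1"
      unfolding ennreal_1[symmetric] by (intro ennreal_leI) simp
  qed auto
  finally show "ennreal (1 / 2) * tail_sum \<phi> f N
      \<le> besov_inf1 \<phi> (- 2) (fst (f0, f1)) + ennreal ?t * besov_inf1 \<phi> 0 (snd (f0, f1))"
    by simp
qed

text \<open>The decomposition is f minus its low part, plus the low part. The triangle inequality
  costs 1 + B on the first and the averaging bound B on the second, so 1 + B factors out of both. N
  and t are independent here; they are tied together in the theorem.\<close>

lemma K_besov_le:
  fixes f :: "(real^'n::finite \<Rightarrow> complex) \<Rightarrow> complex"
  assumes \<phi>: "LP_generator \<phi>" and f: "tempered f"
  shows "K_besov \<phi> t f \<le> ennreal (1 + (LINT w|lborel. norm (\<phi> w)))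
    * (tail_sum \<phi> f N + ennreal t * (\<Sum>j\<le>N + 1. LP_sup \<phi> j f))"
proof -
  let ?f1 = "low_pass \<phi> N f"
  let ?f0 = "\<lambda>h. f h - ?f1 h"
  let ?B = "LINT w|lborel. norm (\<phi> w)"
  let ?w = "\<lambda>j. ennreal (2 powr (- 2 * real j))"
  have B: "?B \<ge> 0" by (rule Bochner_Integration.integral_nonneg) simp
  have t1: "tempered ?f1"
    using \<phi> by (intro tempered_low_pass f) (simp add: LP_generator_def)
  have LP1: "LP_sup \<phi> j ?f1 \<le> ennreal (1 + ?B) * LP_sup \<phi> j f" for j
    by (rule order_trans[OF LP_sup_low_pass(2)[OF \<phi> f] mult_right_mono]) (simp_all add: ennreal_leI)
  have LP0: "LP_sup \<phi> j ?f0 \<le> ennreal (1 + ?B) * LP_sup \<phi> j f" for j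
  proof -
    have "LP_sup \<phi> j ?f0 \<le> LP_sup \<phi> j f + ennreal ?B * LP_sup \<phi> j f"
      by (rule order_trans[OF LP_sup_minus add_left_mono[OF LP_sup_low_pass(2)[OF \<phi> f]]])
    then show ?thesis using B by (simp add: distrib_right)
  qed
  have "K_besov \<phi> t f \<le> besov_inf1 \<phi> (- 2) ?f0 + ennreal t * besov_inf1 \<phi> 0 ?f1"
    unfolding K_besov_def
    by (rule INF_lower2[of "(?f0, ?f1)"]) (auto simp: t1 tempered_minus[OF f t1])
  also have "besov_inf1 \<phi> (- 2) ?f0 \<le> ennreal (1 + ?B) * tail_sum \<phi> f N"
  proof -
    have "LP_sup \<phi> j ?f0 = 0" if "j < N" for j
    proof -
      have "LP \<phi> j ?f0 x = LP \<phi> j f x - LP \<phi> j ?f1 x" for x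
        by (simp add: LP_def)
      then show ?thesis by (simp add: LP_sup_def LP_low_pass_eq[OF \<phi> that])
    qed
    then have "besov_inf1 \<phi> (- 2) ?f0 = tail_sum \<phi> ?f0 N"
      unfolding besov_inf1_def by (subst ennreal_suminf_split[of _ N]) simp
    also have "\<dots> \<le> (\<Sum>j. ennreal (1 + ?B) * (?w (j + N) * LP_sup \<phi> (j + N) f))"
      unfolding mult.left_commute[of "ennreal (1 + ?B)"]
      by (intro suminf_le summableI mult_left_mono LP0) auto
    also have "\<dots> = ennreal (1 + ?B) * tail_sum \<phi> f N"
      by (rule ennreal_suminf_cmult)
    finally show ?thesis .
  qed
  also have "besov_inf1 \<phi> 0 ?f1 \<le> ennreal (1 + ?B) * (\<Sum>j\<le>N + 1. LP_sup \<phi> j f)"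
  proof -
    have "besov_inf1 \<phi> 0 ?f1 = (\<Sum>j\<le>N + 1. LP_sup \<phi> j ?f1)"
      unfolding besov_inf1_def
      by (subst suminf_finite[of "{..N + 1}"]) (auto simp: LP_sup_low_pass(1)[OF \<phi> f])
    then show ?thesis by (simp add: sum_distrib_left sum_mono LP1 del: sum.atMost_Suc ennreal_plus)
  qed
  finally show ?thesis
    by (simp add: distrib_left mult.left_commute add_mono mult_left_mono)
qed

section \<open>The V-norm, doubling and the choice of scale\<close>

lemma tail_sum_le_V_norm:
  assumes "\<Psi> (real N) > 0"
  shows "tail_sum \<phi> f N \<le> ennreal ((\<Psi> (real N))\<^sup>2) * V_norm \<phi> \<Psi> f"
proof -
  have "tail_sum \<phi> f N = ennreal ((\<Psi> (real N))\<^sup>2) * (ennreal (1 / (\<Psi> (real N))\<^sup>2) * tail_sum \<phi> f N)"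
    using assms by (simp add: mult.assoc[symmetric] ennreal_mult[symmetric])
  also have "\<dots> \<le> ennreal ((\<Psi> (real N))\<^sup>2) * V_norm \<phi> \<Psi> f"
    unfolding V_norm_def by (intro mult_left_mono SUP_upper) auto
  finally show ?thesis .
qed

text \<open>A single piece is the first term of the tail that starts at its own index.\<close>

lemma LP_sup_le_V_norm:
  assumes "\<Psi> (real j) > 0"
  shows "LP_sup \<phi> j f \<le> ennreal ((2 ^ j * \<Psi> (real j))\<^sup>2) * V_norm \<phi> \<Psi> f"
proof -
  have four: "(2 ^ j)\<^sup>2 = 2 powr (2 * real j)"
    by (simp add: powr_realpow[symmetric] powr_powr mult.commute)
  have "LP_sup \<phi> j f = ennreal ((2 ^ j)\<^sup>2) * (ennreal (2 powr (- 2 * real (0 + j))) * LP_sup \<phi> (0 + j) f)"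
    unfolding four by (simp add: mult.assoc[symmetric] ennreal_mult[symmetric] powr_add[symmetric])
  also have "\<dots> \<le> ennreal ((2 ^ j)\<^sup>2) * tail_sum \<phi> f j"
    by (intro mult_left_mono ennreal_term_le_suminf[of _ 0]) auto
  also have "\<dots> \<le> ennreal ((2 ^ j)\<^sup>2) * (ennreal ((\<Psi> (real j))\<^sup>2) * V_norm \<phi> \<Psi> f)"
    by (intro mult_left_mono tail_sum_le_V_norm assms) auto
  finally show ?thesis
    by (simp add: mult.assoc[symmetric] ennreal_mult[symmetric] power_mult_distrib)
qed

text \<open>The given dilation factor c may be close to 1. Iterating until c^k > 2 and using
  monotonicity replaces it by 2, the factor that \<open>dyadic_scale\<close> produces.\<close>

lemma doubling_two:
  assumes "decay \<Psi>" "doubling \<Psi>"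
  obtains \<delta> where "\<delta> > 0" "\<And>t. t \<ge> 0 \<Longrightarrow> \<delta> * \<Psi> t \<le> \<Psi> (2 * t)"
proof -
  obtain c C' where c: "c > 1" "C' > 0" "\<And>t. t \<ge> 0 \<Longrightarrow> C' * \<Psi> t \<le> \<Psi> (c * t)"
    using assms(2) unfolding doubling_def by blast
  have iter: "C' ^ k * \<Psi> t \<le> \<Psi> (c ^ k * t)" if "t \<ge> 0" for k t
  proof (induction k)
    case (Suc k)
    have "C' ^ Suc k * \<Psi> t \<le> C' * \<Psi> (c ^ k * t)"
      using Suc c(2) by (simp add: mult.assoc)
    also have "\<dots> \<le> \<Psi> (c ^ Suc k * t)"
      using c(1) c(3)[of "c ^ k * t"] that by (simp add: mult.assoc)
    finally show ?case .
  qed simp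
  obtain k where k: "2 < c ^ k" using real_arch_pow[OF c(1)] by blast
  have "C' ^ k * \<Psi> t \<le> \<Psi> (2 * t)" if "t \<ge> 0" for t
  proof -
    have "0 \<le> 2 * t" "2 * t \<le> c ^ k * t"
      using k that by (auto intro: mult_right_mono)
    then have "\<Psi> (c ^ k * t) \<le> \<Psi> (2 * t)"
      using assms(1) unfolding decay_def by blast
    with iter[OF that, of k] show ?thesis by linarith
  qed
  then show thesis using that[of "C' ^ k"] c by simp
qed

text \<open>N is least with 1 \<le> t 4^N. Minimality bounds t 4^N by 4, and taking logarithms gives
  - ln t \<le> N ln 4 \<le> 2 N.\<close>

lemma dyadic_scale:
  fixes t :: real
  assumes "0 < t" "t < 1"
  obtains N :: nat where "t * 4 ^ N \<le> 4" "- ln t \<le> 2 * real N"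
proof -
  have "\<exists>N. 1 \<le> t * 4 ^ N"
    using real_arch_pow[of 4 "1 / t"] assms by (auto simp: field_simps intro: less_imp_le)
  define N where "N = (LEAST N. 1 \<le> t * 4 ^ N)"
  have N: "1 \<le> t * 4 ^ N"
    unfolding N_def by (rule LeastI_ex) fact
  have "t * 4 ^ N \<le> 4"
  proof (cases N)
    case (Suc M)
    then have "\<not> 1 \<le> t * 4 ^ M"
      using not_less_Least[of M "\<lambda>N. 1 \<le> t * 4 ^ N"] by (simp add: N_def)
    with Suc show ?thesis by simp
  qed (use assms in simp)
  moreover have "- ln t \<le> 2 * real N"
  proof -
    have "0 \<le> ln (t * 4 ^ N)" using N by simp
    also have "\<dots> = ln t + real N * ln (2 ^ 2)"
      using assms by (simp add: ln_mult ln_realpow)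
    also have "\<dots> = ln t + real N * 2 * ln 2"
      by (subst ln_realpow) auto
    also have "\<dots> \<le> ln t + real N * 2 * 1"
      using ln_2_less_1 by (intro add_left_mono mult_left_mono) auto
    finally show ?thesis by simp
  qed
  ultimately show thesis using that by blast
qed

theorem theorem7p6:
  fixes \<Psi> :: "real \<Rightarrow> real" and \<phi> :: "real^'n::finite \<Rightarrow> complex"
  assumes "decay \<Psi>" and "admissible \<Psi>" and "doubling \<Psi>"
    and "LP_generator \<phi>"
  shows "\<exists>c C. c > 0 \<and> C > 0 \<and>
    (\<forall>f. tempered f \<longrightarrow>
       ennreal c * V_norm \<phi> \<Psi> f
         \<le> (SUP t\<in>{0<..<1}. K_besov \<phi> t f * ennreal (1 / (\<Psi> (- ln t))\<^sup>2)) \<and>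
       (SUP t\<in>{0<..<1}. K_besov \<phi> t f * ennreal (1 / (\<Psi> (- ln t))\<^sup>2))
         \<le> ennreal C * V_norm \<phi> \<Psi> f)"
proof -
  have pos: "\<And>t. t \<ge> 0 \<Longrightarrow> \<Psi> t > 0" and mono: "\<And>s t. 0 \<le> s \<Longrightarrow> s \<le> t \<Longrightarrow> \<Psi> t \<le> \<Psi> s"
    using assms(1) unfolding decay_def by blast+
  have \<phi>: "schwartz \<phi>" using assms(4) by (simp add: LP_generator_def)
  obtain \<delta> where \<delta>: "\<delta> > 0" "\<And>t. t \<ge> 0 \<Longrightarrow> \<delta> * \<Psi> t \<le> \<Psi> (2 * t)"
    using doubling_two[OF assms(1,3)] by blast
  obtain A0 where "\<And>N. (\<Sum>r\<le>N. (2 ^ r * \<Psi> (real r))\<^sup>2) \<le> A0 * (2 ^ N * \<Psi> (real N))\<^sup>2"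
    using assms(2) unfolding admissible_def by blast
  \<comment> \<open>The admissibility constant comes without a sign; its absolute value can be
    carried through \<open>ennreal\<close>.\<close>
  then have A: "(\<Sum>r\<le>N. (2 ^ r * \<Psi> (real r))\<^sup>2) \<le> \<bar>A0\<bar> * (2 ^ N * \<Psi> (real N))\<^sup>2" for N
    by (rule order_trans) (intro mult_right_mono, auto)
  define A where "A = \<bar>A0\<bar>"
  define B where "B = (LINT w|lborel. norm (\<phi> w))"
  have B: "B \<ge> 0" unfolding B_def by (rule Bochner_Integration.integral_nonneg) simp
  \<comment> \<open>1 + B is the cost of the split, 1 the tail, 16 A the low frequencies, and the
    square of \<delta> the passage from \<Psi>(N) to \<Psi>(- ln t).\<close>
  define C where "C = (1 + B) * (1 + 16 * A) / \<delta>\<^sup>2"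
  have A0: "A \<ge> 0" by (simp add: A_def)
  have "C > 0" using \<delta>(1) A0 B by (simp add: C_def add_pos_nonneg)
  have lower: "ennreal (1 / 2) * V_norm \<phi> \<Psi> f
      \<le> (SUP t\<in>{0<..<1}. K_besov \<phi> t f * ennreal (1 / (\<Psi> (- ln t))\<^sup>2))" for f
    unfolding V_norm_def SUP_mult_left_ennreal
  proof (rule SUP_least)
    fix N :: nat
    let ?t = "2 powr (- (2 * real N + 1)) :: real"
    have t: "?t \<in> {0<..<1}"
      using powr_less_mono[of "- (2 * real N + 1)" 0 "2::real"] by simp
    \<comment> \<open>Since 2 ln 2 \<ge> 1, - ln t = (2N + 1) ln 2 is at least N, and the decrease
      of \<Psi> points the right way.\<close>
    have "real N * 1 \<le> real N * (2 * ln 2)"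
      using ln2_ge_two_thirds by (intro mult_left_mono) auto
    then have N: "real N \<le> - ln ?t"
      using ln2_ge_two_thirds by (simp add: ln_powr algebra_simps)
    have "1 / (\<Psi> (real N))\<^sup>2 \<le> 1 / (\<Psi> (- ln ?t))\<^sup>2"
      using N pos[of "real N"] pos[of "- ln ?t"] mono[OF _ N]
      by (intro divide_left_mono power_mono) auto
    then have "ennreal (1 / (\<Psi> (real N))\<^sup>2) * (ennreal (1 / 2) * tail_sum \<phi> f N)
        \<le> ennreal (1 / (\<Psi> (- ln ?t))\<^sup>2) * K_besov \<phi> ?t f"
      by (intro mult_mono ennreal_leI half_tail_sum_le_K_besov \<phi>) auto
    also have "\<dots> = K_besov \<phi> ?t f * ennreal (1 / (\<Psi> (- ln ?t))\<^sup>2)"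
      by (rule mult.commute)
    also have "\<dots> \<le> (SUP t\<in>{0<..<1}. K_besov \<phi> t f * ennreal (1 / (\<Psi> (- ln t))\<^sup>2))"
      by (rule SUP_upper[OF t])
    finally show "ennreal (1 / 2) * (ennreal (1 / (\<Psi> (real N))\<^sup>2) * tail_sum \<phi> f N)
      \<le> (SUP t\<in>{0<..<1}. K_besov \<phi> t f * ennreal (1 / (\<Psi> (- ln t))\<^sup>2))"
      by (simp only: mult.left_commute)
  qed
  have upper: "(SUP t\<in>{0<..<1}. K_besov \<phi> t f * ennreal (1 / (\<Psi> (- ln t))\<^sup>2))
      \<le> ennreal C * V_norm \<phi> \<Psi> f" if f: "tempered f" for f
  proof (rule SUP_least)
    fix t :: real assume "t \<in> {0<..<1}"
    then have t: "0 < t" "t < 1" by auto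
    obtain N where N: "t * 4 ^ N \<le> 4" "- ln t \<le> 2 * real N"
      using dyadic_scale[OF t] by blast
    let ?V = "V_norm \<phi> \<Psi> f"
    have ln: "- ln t \<ge> 0" using t by simp
    have "\<delta> * \<Psi> (real N) \<le> \<Psi> (- ln t)"
      using \<delta>(2)[of "real N"] mono[OF ln N(2)] by simp
    then have "(\<delta> * \<Psi> (real N))\<^sup>2 \<le> (\<Psi> (- ln t))\<^sup>2"
      using \<delta>(1) pos[of "real N"] by (intro power_mono) auto
    then have "(\<Psi> (real N))\<^sup>2 * (1 / (\<Psi> (- ln t))\<^sup>2) \<le> 1 / \<delta>\<^sup>2"
      using \<delta>(1) pos[OF ln] by (simp add: field_simps power_mult_distrib)
    then have "(1 + B) * (1 + 16 * A) * ((\<Psi> (real N))\<^sup>2 * (1 / (\<Psi> (- ln t))\<^sup>2))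
        \<le> (1 + B) * (1 + 16 * A) * (1 / \<delta>\<^sup>2)"
      using A0 B by (intro mult_left_mono) auto
    then have C: "(1 + B) * (1 + 16 * A) * (\<Psi> (real N))\<^sup>2 * (1 / (\<Psi> (- ln t))\<^sup>2) \<le> C"
      by (simp add: C_def mult.assoc)
    have "(\<Sum>j\<le>N + 1. LP_sup \<phi> j f) \<le> (\<Sum>j\<le>N + 1. ennreal ((2 ^ j * \<Psi> (real j))\<^sup>2) * ?V)"
      by (intro sum_mono LP_sup_le_V_norm pos) simp
    also have "\<dots> = ennreal (\<Sum>j\<le>N + 1. (2 ^ j * \<Psi> (real j))\<^sup>2) * ?V"
      by (simp add: sum_distrib_right[symmetric] del: sum.atMost_Suc)
    \<comment> \<open>Admissibility is used at N + 1, the last index present in the low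
      part.\<close>
    also have "\<dots> \<le> ennreal (A * (2 ^ (N + 1) * \<Psi> (real (N + 1)))\<^sup>2) * ?V"
      using A[of "N + 1"] by (intro mult_right_mono ennreal_leI) (auto simp: A_def)
    finally have "ennreal t * (\<Sum>j\<le>N + 1. LP_sup \<phi> j f)
        \<le> ennreal t * (ennreal (A * (2 ^ (N + 1) * \<Psi> (real (N + 1)))\<^sup>2) * ?V)"
      by (rule mult_left_mono) simp
    also have "\<dots> = ennreal (t * (A * (2 ^ (N + 1) * \<Psi> (real (N + 1)))\<^sup>2)) * ?V"
      using t A0 by (simp add: mult.assoc[symmetric] ennreal_mult[symmetric])
    also have "\<dots> \<le> ennreal (16 * A * (\<Psi> (real N))\<^sup>2) * ?V"
    proof (intro mult_right_mono ennreal_leI)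
      \<comment> \<open>One factor 4 comes from the index N + 1 and another from t 4^N \<le> 4,
        hence 16.\<close>
      have "(2 ^ (N + 1) :: real)\<^sup>2 = 4 * 4 ^ N"
        by (simp add: power_mult_distrib power2_eq_square power_mult_distrib[symmetric])
      then have "t * (A * (2 ^ (N + 1) * \<Psi> (real (N + 1)))\<^sup>2) = 4 * A * ((t * 4 ^ N) * (\<Psi> (real (N + 1)))\<^sup>2)"
        by (simp add: power_mult_distrib)
      also have "\<dots> \<le> 4 * A * (4 * (\<Psi> (real N))\<^sup>2)"
        using A0 N(1) pos[of "real (N + 1)"] mono[of "real N" "real (N + 1)"]
        by (intro mult_left_mono mult_mono power_mono) auto
      finally show "t * (A * (2 ^ (N + 1) * \<Psi> (real (N + 1)))\<^sup>2) \<le> 16 * A * (\<Psi> (real N))\<^sup>2" by simp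
    qed simp
    finally have low: "ennreal t * (\<Sum>j\<le>N + 1. LP_sup \<phi> j f) \<le> ennreal (16 * A * (\<Psi> (real N))\<^sup>2) * ?V" .
    have "K_besov \<phi> t f \<le> ennreal (1 + B) * (tail_sum \<phi> f N + ennreal t * (\<Sum>j\<le>N + 1. LP_sup \<phi> j f))"
      unfolding B_def by (rule K_besov_le[OF assms(4) f])
    also have "\<dots> \<le> ennreal (1 + B) * (ennreal ((\<Psi> (real N))\<^sup>2) * ?V + ennreal (16 * A * (\<Psi> (real N))\<^sup>2) * ?V)"
      by (intro mult_left_mono add_mono low tail_sum_le_V_norm pos) auto
    also have "\<dots> = ennreal ((1 + B) * (1 + 16 * A) * (\<Psi> (real N))\<^sup>2) * ?V"
    proof -
      have "(1 + B) * (1 + 16 * A) * (\<Psi> (real N))\<^sup>2 = (1 + B) * ((\<Psi> (real N))\<^sup>2 + 16 * A * (\<Psi> (real N))\<^sup>2)"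
        by (simp add: algebra_simps)
      then show ?thesis
        using A0 B by (simp only: ennreal_mult ennreal_plus distrib_right[symmetric] mult.assoc[symmetric]
            zero_le_power2 add_nonneg_nonneg mult_nonneg_nonneg zero_le_one zero_le_numeral)
    qed
    finally have "K_besov \<phi> t f * ennreal (1 / (\<Psi> (- ln t))\<^sup>2)
        \<le> ennreal ((1 + B) * (1 + 16 * A) * (\<Psi> (real N))\<^sup>2) * ?V * ennreal (1 / (\<Psi> (- ln t))\<^sup>2)"
      by (rule mult_right_mono) simp
    also have "\<dots> = ennreal ((1 + B) * (1 + 16 * A) * (\<Psi> (real N))\<^sup>2 * (1 / (\<Psi> (- ln t))\<^sup>2)) * ?V"
      using A0 B by (subst (2) ennreal_mult) (auto simp: mult_ac)
    also have "\<dots> \<le> ennreal C * ?V"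
      by (intro mult_right_mono ennreal_leI C) simp
    finally show "K_besov \<phi> t f * ennreal (1 / (\<Psi> (- ln t))\<^sup>2) \<le> ennreal C * ?V" .
  qed
  show ?thesis
    using lower upper \<open>C > 0\<close> by (intro exI[of _ "1 / 2"] exI[of _ C]) auto
qed

end
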